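(* Let $\mathfrak g$ be a root-reductive Lie algebra over $\mathbb K$ with a splitting Borel subalgebra $\mathfrak b$ containing a splitting maximal toral subalgebra $\mathfrak h$. Every object in $\bar{\mathcal O}$ admits a unique, up to isomorphism, decomposition into a direct sum of indecomposable objects. That is, every $M\in\bar{\mathcal O}$ is a direct sum of indecomposable objects of $\bar{\mathcal O}$, and if $M=\bigoplus_{j\in J}M_j=\bigoplus_{j'\in J'}M'_{j'}$ with all $M_j,M'_{j'}\in\bar{\mathcal O}$ indecomposable, then there is a bijection $\psi:J\to J'$ with $M_j\cong M'_{\psi(j)}$ for every $j\in J$.
   Context: $\mathbb K$ is an algebraically closed field of characteristic $0$; all Lie algebras and vector spaces are over $\mathbb K$. A Lie algebra $\mathfrak g$ is root-reductive if $\mathfrak g=\bigcup_{n\ge1}\mathfrak g_n$ for nested finite-dimensional reductive subalgebras $\mathfrak g_1\subseteq\mathfrak g_2\subseteq\cdots$, with $\mathfrak g_n$ reductive in $\mathfrak g_{n+1}$, such that there are nested subalgebras $\mathfrak k_1\subseteq\mathfrak k_2\subseteq\cdots$ with $\mathfrak k_n$ a Cartan subalgebra of $\mathfrak g_n$ and each inclusion $\mathfrak g_n\hookrightarrow\mathfrak g_{n+1}$ is a root inclusion with respect to $\mathfrak k_{n+1}$, i.e. $\mathfrak g_n\cap\mathfrak k_{n+1}$ is a Cartan subalgebra of $\mathfrak g_n$ and each $(\mathfrak g_n\cap\mathfrak k_{n+1})$-root space of $\mathfrak g_n$ is a root space of $\mathfrak g_{n+1}$. A subalgebra $\mathfrak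 h$ is a splitting maximal toral subalgebra if $\mathfrak g$ is a directed union of finite-dimensional reductive subalgebras $\mathfrak g_n$ with $\mathfrak h\cap\mathfrak g_n$ maximal toral in $\mathfrak g_n$, and $\mathfrak g=\mathfrak h\oplus\bigoplus_{\alpha\in\Delta}\mathfrak g^\alpha$ is the root space decomposition. A splitting Borel subalgebra is a maximal locally solvable subalgebra containing a splitting maximal toral subalgebra. Put $\mathfrak n=[\mathfrak b,\mathfrak b]$. Standing assumption: the exhaustion $(\mathfrak g_n)$ is chosen so that $\mathfrak h\cap\mathfrak g_n$ is maximal toral in $\mathfrak g_n$ and $\mathfrak b\cap\mathfrak g_n$ is a Borel subalgebra of $\mathfrak g_n$. $\bar{\mathcal O}$ is the full subcategory of $\mathfrak g$-modules $M$ such that (i) $M=\bigoplus_{\lambda\in\mathfrak h^*}M^\lambda$ is an $\mathfrak h$-weight module with all weight spaces $M^\lambda$ finite-dimensional; (ii) $M$ is locally $\mathfrak n$-finite: $\dim U(\mathfrak n)\cdot v<\infty$ for all $v\in M$. Direct sums may have infinitely many summands. *)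

theory Defs
  imports "HOL-Computational_Algebra.Polynomial" "HOL-Library.FuncSet"
begin

context vector_space
begin

definition fin_dim :: "'b set \<Rightarrow> bool" where
  "fin_dim V \<longleftrightarrow> (\<exists>B. finite B \<and> V \<subseteq> span B)"

definition complementary :: "'b set \<Rightarrow> 'b set \<Rightarrow> 'b set \<Rightarrow> bool" where
  "complementary V A B \<longleftrightarrow> A \<inter> B = {0} \<and> V = {a + b | a b. a \<in> A \<and> b \<in> B}"

text \<open>Internal direct sum of a possibly infinite family of subspaces: every \<open>v\<close> is in a unique way
  a finitely supported sum of elements of the summands.\<close>

definition direct_sum :: "'b set \<Rightarrow> 'i set \<Rightarrow> ('i \<Rightarrow> 'b set) \<Rightarrow> bool" where
  "direct_sum V J N \<longleftrightarrow>
     subspace V \<and> (\<forall>j\<in>J. subspace (N j) \<and> N j \<subseteq> V) \<and>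
     (\<forall>v\<in>V. \<exists>!f. finite {j. f j \<noteq> 0} \<and> (\<forall>j\<in>J. f j \<in> N j) \<and> (\<forall>j. j \<notin> J \<longrightarrow> f j = 0) \<and>
                 v = (\<Sum>j | f j \<noteq> 0. f j))"

text \<open>Linear functionals on a subspace, normalised to \<^const>\<open>undefined\<close> outside of it so that each
  functional is represented by exactly one function; this matters when functionals index
  direct sums.\<close>

definition dual :: "'b set \<Rightarrow> ('b \<Rightarrow> 'a) set" where
  "dual V = {\<alpha> \<in> extensional V.
     (\<forall>x\<in>V. \<forall>y\<in>V. \<alpha> (x + y) = \<alpha> x + \<alpha> y) \<and> (\<forall>c. \<forall>x\<in>V. \<alpha> (c *s x) = c * \<alpha> x)}"

end

locale lie_algebra = vector_space scale
  for scale :: "'k::field \<Rightarrow> 'g::ab_group_add \<Rightarrow> 'g" (infixr \<open>*s\<close> 75) +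
  fixes bracket :: "'g \<Rightarrow> 'g \<Rightarrow> 'g"
  assumes bracket_add_left: "bracket (x + y) z = bracket x z + bracket y z"
    and bracket_add_right: "bracket x (y + z) = bracket x y + bracket x z"
    and bracket_scale_left: "bracket (c *s x) y = c *s bracket x y"
    and bracket_scale_right: "bracket x (c *s y) = c *s bracket x y"
    and bracket_self: "bracket x x = 0"
    and jacobi: "bracket x (bracket y z) + bracket y (bracket z x) + bracket z (bracket x y) = 0"
begin

definition brackets :: "'g set \<Rightarrow> 'g set \<Rightarrow> 'g set" where
  "brackets A B = span {bracket a b | a b. a \<in> A \<and> b \<in> B}"

definition subalgebra :: "'g set \<Rightarrow> bool" where
  "subalgebra k \<longleftrightarrow> subspace k \<and> (\<forall>x\<in>k. \<forall>y\<in>k. bracket x y \<in> k)"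

definition solvable :: "'g set \<Rightarrow> bool" where
  "solvable k \<longleftrightarrow> (\<exists>n. ((\<lambda>s. brackets s s) ^^ n) k = {0})"

definition nilpotent :: "'g set \<Rightarrow> bool" where
  "nilpotent k \<longleftrightarrow> (\<exists>n. ((\<lambda>s. brackets k s) ^^ n) k = {0})"

definition locally_solvable :: "'g set \<Rightarrow> bool" where
  "locally_solvable k \<longleftrightarrow>
     (\<forall>F. finite F \<and> F \<subseteq> k \<longrightarrow> (\<exists>s. subalgebra s \<and> solvable s \<and> F \<subseteq> s \<and> s \<subseteq> k))"

text \<open>The set \<open>S\<close> acts semisimply on \<open>V\<close> by the adjoint action: every stable subspace has a stable
  complement. For \<open>S\<close> a subalgebra this is semisimplicity of the \<open>S\<close>-module \<open>V\<close>; for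
  \<open>S = {x}\<close> it says that the endomorphism \<open>ad x\<close> of \<open>V\<close> is semisimple.\<close>

definition ad_stable :: "'g set \<Rightarrow> 'g set \<Rightarrow> bool" where
  "ad_stable S W \<longleftrightarrow> subspace W \<and> (\<forall>x\<in>S. \<forall>w\<in>W. bracket x w \<in> W)"

definition ad_semisimple :: "'g set \<Rightarrow> 'g set \<Rightarrow> bool" where
  "ad_semisimple S V \<longleftrightarrow>
     (\<forall>W. ad_stable S W \<and> W \<subseteq> V \<longrightarrow>
       (\<exists>W'. ad_stable S W' \<and> W' \<subseteq> V \<and> complementary V W W'))"

definition reductive_in :: "'g set \<Rightarrow> 'g set \<Rightarrow> bool" where
  "reductive_in k l \<longleftrightarrow> subalgebra k \<and> subalgebra l \<and> k \<subseteq> l \<and> ad_semisimple k l"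

definition reductive :: "'g set \<Rightarrow> bool" where
  "reductive k \<longleftrightarrow> subalgebra k \<and> ad_semisimple k k"

definition cartan_subalgebra :: "'g set \<Rightarrow> 'g set \<Rightarrow> bool" where
  "cartan_subalgebra c k \<longleftrightarrow> subalgebra c \<and> c \<subseteq> k \<and> nilpotent c \<and>
     {x \<in> k. \<forall>y\<in>c. bracket x y \<in> c} = c"

definition root_space :: "'g set \<Rightarrow> 'g set \<Rightarrow> ('g \<Rightarrow> 'k) \<Rightarrow> 'g set" where
  "root_space h k \<alpha> = {x \<in> k. \<forall>H\<in>h. bracket H x = \<alpha> H *s x}"

definition roots :: "'g set \<Rightarrow> 'g set \<Rightarrow> ('g \<Rightarrow> 'k) set" where
  "roots h k = {\<alpha> \<in> dual h. (\<exists>H\<in>h. \<alpha> H \<noteq> 0) \<and> root_space h k \<alpha> \<noteq> {0}}"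

definition root_inclusion :: "'g set \<Rightarrow> 'g set \<Rightarrow> 'g set \<Rightarrow> bool" where
  "root_inclusion k l c \<longleftrightarrow> k \<subseteq> l \<and> cartan_subalgebra (k \<inter> c) k \<and>
     (\<forall>\<alpha>\<in>roots (k \<inter> c) k. \<exists>\<beta>\<in>roots c l. root_space (k \<inter> c) k \<alpha> = root_space c l \<beta>)"

definition root_reductive_exhaustion :: "(nat \<Rightarrow> 'g set) \<Rightarrow> bool" where
  "root_reductive_exhaustion G \<longleftrightarrow>
     (\<Union>n. G n) = UNIV \<and>
     (\<forall>n. subalgebra (G n) \<and> fin_dim (G n) \<and> reductive (G n)) \<and>
     (\<forall>n. G n \<subseteq> G (Suc n) \<and> reductive_in (G n) (G (Suc n))) \<and>
     (\<exists>K. (\<forall>n. K n \<subseteq> K (Suc n) \<and> cartan_subalgebra (K n) (G n)) \<and>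
          (\<forall>n. root_inclusion (G n) (G (Suc n)) (K (Suc n))))"

definition root_reductive :: bool where
  "root_reductive \<longleftrightarrow> (\<exists>G. root_reductive_exhaustion G)"

definition toral_in :: "'g set \<Rightarrow> 'g set \<Rightarrow> bool" where
  "toral_in t k \<longleftrightarrow> subalgebra t \<and> t \<subseteq> k \<and> (\<forall>x\<in>t. ad_semisimple {x} k)"

definition maximal_toral_in :: "'g set \<Rightarrow> 'g set \<Rightarrow> bool" where
  "maximal_toral_in t k \<longleftrightarrow> toral_in t k \<and> (\<forall>t'. toral_in t' k \<and> t \<subseteq> t' \<longrightarrow> t' = t)"

definition splitting_maximal_toral :: "'g set \<Rightarrow> bool" where
  "splitting_maximal_toral h \<longleftrightarrow> subalgebra h \<and>
     (\<exists>\<G>. \<G> \<noteq> {} \<and> \<Union>\<G> = UNIV \<and> (\<forall>k\<in>\<G>. \<forall>l\<in>\<G>. \<exists>m\<in>\<G>. k \<subseteq> m \<and> l \<subseteq> m) \<and>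
        (\<forall>k\<in>\<G>. subalgebra k \<and> fin_dim k \<and> reductive k \<and> maximal_toral_in (h \<inter> k) k)) \<and>
     direct_sum UNIV (insert None (Some ` roots h UNIV)) (case_option h (root_space h UNIV))"

definition borel_subalgebra_in :: "'g set \<Rightarrow> 'g set \<Rightarrow> bool" where
  "borel_subalgebra_in b k \<longleftrightarrow> subalgebra b \<and> b \<subseteq> k \<and> solvable b \<and>
     (\<forall>b'. subalgebra b' \<and> b' \<subseteq> k \<and> solvable b' \<and> b \<subseteq> b' \<longrightarrow> b' = b)"

definition splitting_borel :: "'g set \<Rightarrow> bool" where
  "splitting_borel b \<longleftrightarrow> subalgebra b \<and> locally_solvable b \<and>
     (\<forall>b'. subalgebra b' \<and> locally_solvable b' \<and> b \<subseteq> b' \<longrightarrow> b' = b) \<and>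
     (\<exists>h. splitting_maximal_toral h \<and> h \<subseteq> b)"

end

locale lie_module = lie_algebra scale bracket + M: vector_space scaleM
  for scale :: "'k::field \<Rightarrow> 'g::ab_group_add \<Rightarrow> 'g" (infixr \<open>*s\<close> 75)
    and bracket :: "'g \<Rightarrow> 'g \<Rightarrow> 'g"
    and scaleM :: "'k \<Rightarrow> 'm::ab_group_add \<Rightarrow> 'm" (infixr \<open>*m\<close> 75) +
  fixes act :: "'g \<Rightarrow> 'm \<Rightarrow> 'm"
  assumes act_add_left: "act (x + y) v = act x v + act y v"
    and act_add_right: "act x (v + w) = act x v + act x w"
    and act_scale_left: "act (c *s x) v = c *m act x v"
    and act_scale_right: "act x (c *m v) = c *m act x v"
    and act_bracket: "act (bracket x y) v = act x (act y v) - act y (act x v)"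
begin

definition submodule :: "'m set \<Rightarrow> bool" where
  "submodule V \<longleftrightarrow> M.subspace V \<and> (\<forall>x. \<forall>v\<in>V. act x v \<in> V)"

definition weight_space :: "'g set \<Rightarrow> ('g \<Rightarrow> 'k) \<Rightarrow> 'm set" where
  "weight_space h \<mu> = {v. \<forall>H\<in>h. act H v = \<mu> H *m v}"

text \<open>\<open>U(\<nn>) \<cdot> v\<close>: the enveloping algebra is spanned by the products
  \<open>x\<^sub>1 \<cdots> x\<^sub>k\<close> with all \<open>x\<^sub>i \<in> \<nn>\<close> (and \<open>k \<ge> 0\<close>), acting as \<open>x\<^sub>1 (\<cdots> (x\<^sub>k v))\<close>.\<close>

definition enveloping_orbit :: "'g set \<Rightarrow> 'm \<Rightarrow> 'm set" where
  "enveloping_orbit n v = M.span {foldr act xs v | xs. set xs \<subseteq> n}"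

text \<open>The objects of the category are represented as submodules of an ambient module; the
  whole ambient module is the case \<open>V = UNIV\<close>.\<close>

definition category_O_bar :: "'g set \<Rightarrow> 'g set \<Rightarrow> 'm set \<Rightarrow> bool" where
  "category_O_bar b h V \<longleftrightarrow> submodule V \<and>
     M.direct_sum V (dual h) (\<lambda>\<mu>. V \<inter> weight_space h \<mu>) \<and>
     (\<forall>\<mu>\<in>dual h. M.fin_dim (V \<inter> weight_space h \<mu>)) \<and>
     (\<forall>v\<in>V. M.fin_dim (enveloping_orbit (brackets b b) v))"

definition indecomposable_object :: "'g set \<Rightarrow> 'g set \<Rightarrow> 'm set \<Rightarrow> bool" where
  "indecomposable_object b h V \<longleftrightarrow> category_O_bar b h V \<and> V \<noteq> {0} \<and>
     \<not> (\<exists>A B. category_O_bar b h A \<and> category_O_bar b h B \<and> A \<noteq> {0} \<and> B \<noteq> {0} \<and>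
              M.complementary V A B)"

definition indecomposable_decomposition ::
    "'g set \<Rightarrow> 'g set \<Rightarrow> 'i set \<Rightarrow> ('i \<Rightarrow> 'm set) \<Rightarrow> bool" where
  "indecomposable_decomposition b h J N \<longleftrightarrow>
     M.direct_sum UNIV J N \<and> (\<forall>j\<in>J. indecomposable_object b h (N j))"

definition isomorphic :: "'m set \<Rightarrow> 'm set \<Rightarrow> bool" where
  "isomorphic V W \<longleftrightarrow> (\<exists>f. bij_betw f V W \<and>
     (\<forall>v\<in>V. \<forall>w\<in>V. f (v + w) = f v + f w) \<and> (\<forall>c. \<forall>v\<in>V. f (c *m v) = c *m f v) \<and>
     (\<forall>x. \<forall>v\<in>V. f (act x v) = act x (f v)))"

end

end

theory Submission
  imports Defs
begin

text \<open>
  Weights are functionals on \<open>\<hh>\<close>, so distinct weights differ at some element of \<open>\<hh>\<close>. Hence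
  submodules of \<open>M\<close> are spanned by their weight vectors and are themselves objects of the category,
  and homomorphisms preserve the finite-dimensional weight spaces. The statement is therefore the
  Krull--Remak--Schmidt--Azumaya theorem for modules that are direct sums of finite-dimensional
  pieces stable under all homomorphisms.

  \<^bold>\<open>Existence.\<close> By Zorn's lemma there is a maximal set \<open>E\<close> of commuting idempotent endomorphisms of
  \<open>M\<close>. On each weight space the elements of \<open>E\<close> are simultaneously diagonalisable with eigenvalues
  \<open>0\<close> and \<open>1\<close>, so \<open>M\<close> is the direct sum of the joint eigenspaces of \<open>E\<close>, which are submodules. If
  such an eigenspace \<open>X\<close> were \<open>A \<oplus> B\<close>, the projection of \<open>M\<close> onto \<open>A\<close> along \<open>B\<close> and
  the other eigenspaces would commute with \<open>E\<close>, hence lie in \<open>E\<close> and act on \<open>X\<close> as \<open>0\<close> or \<open>1\<close>,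
  which forces \<open>A = 0\<close> or \<open>B = 0\<close> (\<open>decomposition_exists\<close>).

  \<^bold>\<open>Uniqueness.\<close> Applying the Fitting decomposition in every weight space, an endomorphism of an
  indecomposable \<open>V\<close> is bijective or locally nilpotent (\<open>locally_nilpotent_or_bijective\<close>), so the
  locally nilpotent ones form a left ideal of the endomorphism ring. Since the field is algebraically closed, every endomorphism
  is a scalar plus a locally nilpotent one. An indecomposable \<open>V\<close> occurs only finitely often in a
  decomposition, because each copy of \<open>V\<close> takes up room in a fixed weight space. To see that the
  multiplicity does not depend on the decomposition, suppose it were \<open>n\<close> in one and \<open>m < n\<close> in
  another. A non-zero solution of \<open>m\<close> linear equations in \<open>n\<close> unknowns combines the \<open>n\<close> embeddings
  \<open>V \<rightarrow> M\<close> of the first decomposition into a map \<open>f\<close> whose composites with the \<open>m\<close> projections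
  \<open>M \<rightarrow> V\<close> of the second are locally nilpotent. Summing over all summands of the second
  decomposition, every \<open>V \<rightarrow> M \<rightarrow> V\<close> that starts with \<open>f\<close> is locally nilpotent, whereas a suitable
  projection of the first decomposition makes it a non-zero scalar (\<open>multiplicity_le\<close>). Matching
  the equinumerous isomorphism classes gives the bijection.
\<close>

section \<open>Linear algebra and counting\<close>

text \<open>Gaussian elimination: the equation that is removed is used to eliminate the unknown \<open>p\<close> from the
  others.\<close>

lemma homogeneous_system_nontrivial_solution:
  fixes a :: "'i \<Rightarrow> 'j \<Rightarrow> 'k::field"
  assumes "finite K" and "finite I" and "card K < card I"
  shows "\<exists>x. (\<exists>i\<in>I. x i \<noteq> 0) \<and> (\<forall>k\<in>K. (\<Sum>i\<in>I. a k i * x i) = 0)"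
  using assms
proof (induction K arbitrary: I a rule: finite_induct)
  case empty
  then have "I \<noteq> {}" by auto
  then show ?case by (intro exI[of _ "\<lambda>_. 1"]) auto
next
  case (insert k K)
  show ?case
  proof (cases "\<forall>i\<in>I. a k i = 0")
    case True
    from insert.IH[of I a] insert.prems insert.hyps
    obtain x where "\<exists>i\<in>I. x i \<noteq> 0" "\<forall>k\<in>K. (\<Sum>i\<in>I. a k i * x i) = 0"
      by auto
    with True show ?thesis
      by (intro exI[of _ x]) auto
  next
    case False
    then obtain p where p: "p \<in> I" "a k p \<noteq> 0" by auto
    define a' where "a' = (\<lambda>l i. a l i - a l p * a k i / a k p)"
    have "card K < card (I - {p})" using insert.prems insert.hyps p by simp
    then obtain x where x: "\<exists>i\<in>I - {p}. x i \<noteq> 0" "\<forall>l\<in>K. (\<Sum>i\<in>I - {p}. a' l i * x i) = 0"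
      using insert.IH[of "I - {p}" a'] insert.prems(1) by auto
    define y where "y = x(p := - (\<Sum>i\<in>I - {p}. a k i * x i) / a k p)"
    have split: "(\<Sum>i\<in>I. a l i * y i) = a l p * y p + (\<Sum>i\<in>I - {p}. a l i * x i)" for l
      using insert.prems p by (subst sum.remove[of I p]) (auto simp: y_def intro!: sum.cong)
    have "(\<Sum>i\<in>I. a l i * y i) = (\<Sum>i\<in>I - {p}. a' l i * x i)" for l
      unfolding split
      by (simp add: y_def a'_def algebra_simps sum_subtractf sum_distrib_left sum_divide_distrib)
    moreover have "(\<Sum>i\<in>I. a k i * y i) = 0"
      unfolding split using p by (simp add: y_def)
    ultimately show ?thesis
      using x by (intro exI[of _ y]) (auto simp: y_def)
  qed
qed

text \<open>For idempotents \<open>E\<close> this is the simultaneous eigenspace on which the elements of \<open>S\<close> have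
  eigenvalue \<open>1\<close> and the remaining ones eigenvalue \<open>0\<close>.\<close>

definition joint_eigenspace :: "('b \<Rightarrow> 'b) set \<Rightarrow> ('b \<Rightarrow> 'b) set \<Rightarrow> 'b::zero set" where
  "joint_eigenspace E S = {v. \<forall>e\<in>E. e v = (if e \<in> S then v else 0)}"

context vector_space
begin

lemma subspace_dim_strict_mono:
  assumes A: "subspace A" and AB: "A \<subset> B" and B: "fin_dim B"
  shows "dim A < dim B"
proof -
  from B obtain T where T: "finite T" "B \<subseteq> span T" by (auto simp: fin_dim_def)
  obtain S where S: "S \<subseteq> A" "independent S" "A \<subseteq> span S" "card S = dim A" by (rule basis_exists)
  obtain R where R: "R \<subseteq> B" "independent R" "B \<subseteq> span R" "card R = dim B" by (rule basis_exists)
  from AB obtain a where a: "a \<in> B" "a \<notin> A" by auto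
  have "span S = A" using S A by (simp add: span_subspace)
  with a have aS: "independent (insert a S)" using S by (intro independent_insertI) auto
  have "finite R" using independent_span_bound[OF T(1) R(2)] R T by auto
  moreover have "insert a S \<subseteq> span R" using a S AB R by auto
  ultimately have "finite (insert a S)" "card (insert a S) \<le> card R"
    using independent_span_bound[OF _ aS] by auto
  moreover have "a \<notin> S" using a S by auto
  ultimately show ?thesis using S R by auto
qed

lemma fin_dim_subset: "fin_dim V \<Longrightarrow> U \<subseteq> V \<Longrightarrow> fin_dim U"
  by (meson fin_dim_def subset_trans)

lemma subspace_eqI_dim:
  assumes "subspace A" and "A \<subseteq> B" and "fin_dim B" and "dim B \<le> dim A"
  shows "A = B"
  using assms subspace_dim_strict_mono[of A B] by auto

lemma subspace_dim_mono:
  assumes "subspace A" and "A \<subseteq> B" and "fin_dim B"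
  shows "dim A \<le> dim B"
  using assms subspace_dim_strict_mono[of A B] by (cases "A = B") (auto simp: psubset_eq)

text \<open>The Fitting decomposition of \<open>U\<close> into the kernel and the image of a high power of \<open>f\<close>. The second
  part is described by membership in the images of all powers, so that it does not mention \<open>n\<close>.\<close>

lemma fitting_finite_dimensional:
  assumes U: "subspace U" "fin_dim U"
    and add: "\<And>v w. v \<in> U \<Longrightarrow> w \<in> U \<Longrightarrow> f (v + w) = f v + f w"
    and scale: "\<And>c v. v \<in> U \<Longrightarrow> f (c *s v) = c *s f v"
    and maps: "\<And>v. v \<in> U \<Longrightarrow> f v \<in> U"
  obtains n where
    "\<And>v. v \<in> U \<Longrightarrow> \<exists>a\<in>U. \<exists>b. v = a + b \<and> (f ^^ n) a = 0 \<and> (\<forall>m. b \<in> (f ^^ m) ` U)"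
    "\<And>v m. v \<in> (f ^^ n) ` U \<Longrightarrow> (f ^^ m) v = 0 \<Longrightarrow> v = 0"
proof -
  have mapsn: "(f ^^ m) v \<in> U" if "v \<in> U" for m v
    using that by (induction m) (auto simp: maps)
  have addn: "(f ^^ m) (v + w) = (f ^^ m) v + (f ^^ m) w" if "v \<in> U" "w \<in> U" for m v w
    using that by (induction m) (auto simp: add mapsn)
  have scalen: "(f ^^ m) (c *s v) = c *s (f ^^ m) v" if "v \<in> U" for m c v
    using that by (induction m) (auto simp: scale mapsn)
  have zeron: "(f ^^ m) 0 = 0" for m
    using scalen[of 0 m 0] U(1) by (simp add: subspace_0)
  define Im where "Im m = (f ^^ m) ` U" for m
  define Ker where "Ker m = {v \<in> U. (f ^^ m) v = 0}" for m
  have sIm: "subspace (Im m)" for m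
    unfolding subspace_def
  proof (intro conjI ballI allI)
    show "0 \<in> Im m"
      unfolding Im_def using zeron[of m] subspace_0[OF U(1)] by (rule image_eqI[OF sym])
  next
    fix x y assume "x \<in> Im m" "y \<in> Im m"
    then obtain u w where "u \<in> U" "w \<in> U" "x = (f ^^ m) u" "y = (f ^^ m) w"
      unfolding Im_def by blast
    then show "x + y \<in> Im m"
      unfolding Im_def by (intro image_eqI[of _ _ "u + w"]) (simp_all only: addn subspace_add[OF U(1)])
  next
    fix c x assume "x \<in> Im m"
    then obtain u where "u \<in> U" "x = (f ^^ m) u" unfolding Im_def by blast
    then show "c *s x \<in> Im m"
      unfolding Im_def by (intro image_eqI[of _ _ "c *s u"]) (simp_all only: scalen subspace_scale[OF U(1)])
  qed
  have sKer: "subspace (Ker m)" for m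
    using U(1) zeron addn scalen by (auto simp: Ker_def subspace_def)
  have ImU: "Im m \<subseteq> U" and KerU: "Ker m \<subseteq> U" for m
    using mapsn by (auto simp: Im_def Ker_def)
  have Im_anti: "Im (m + n) \<subseteq> Im n" for m n
  proof
    fix x assume "x \<in> Im (m + n)"
    then obtain u where "u \<in> U" "x = (f ^^ (n + m)) u" by (auto simp: Im_def add.commute)
    then have "x = (f ^^ n) ((f ^^ m) u)" by (simp add: funpow_add)
    then show "x \<in> Im n" using mapsn \<open>u \<in> U\<close> by (auto simp: Im_def)
  qed
  have Ker_mono: "Ker n \<subseteq> Ker (m + n)" for m n
    using zeron by (auto simp: Ker_def funpow_add)
  have fd: "fin_dim (Im m)" "fin_dim (Ker m)" for m
    using fin_dim_subset[OF U(2)] ImU KerU by auto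
  \<comment> \<open>Both summands are non-increasing in \<open>m\<close>, so a minimiser of the sum is an exponent from which
    on neither the images nor the kernels of the powers change.\<close>
  define \<mu> where "\<mu> m = dim (Im m) + (dim U - dim (Ker m))" for m
  obtain n where n: "\<And>m. \<mu> n \<le> \<mu> m"
    using ex_has_least_nat[of "\<lambda>_. True" 0 \<mu>] by auto
  have stable: "Im (m + n) = Im n \<and> Ker (m + n) = Ker n" for m
  proof -
    have 1: "dim (Im (m + n)) \<le> dim (Im n)" using sIm Im_anti fd by (intro subspace_dim_mono)
    have 2: "dim (Ker n) \<le> dim (Ker (m + n))" using sKer Ker_mono fd by (intro subspace_dim_mono)
    have 3: "dim (Ker (m + n)) \<le> dim U" using sKer KerU U by (intro subspace_dim_mono)
    have "dim (Im n) \<le> dim (Im (m + n))" "dim (Ker (m + n)) \<le> dim (Ker n)"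
      using n[of "m + n"] 1 2 3 by (auto simp: \<mu>_def)
    then show ?thesis
      using subspace_eqI_dim[OF sIm Im_anti fd(1)] subspace_eqI_dim[OF sKer Ker_mono fd(2)]
      by metis
  qed
  show ?thesis
  proof (rule that[of n])
    fix v assume v: "v \<in> U"
    have "(f ^^ n) v \<in> Im (n + n)" using stable[of n] v by (auto simp: Im_def)
    then obtain u where u: "u \<in> U" "(f ^^ n) v = (f ^^ (n + n)) u" by (auto simp: Im_def)
    define b where "b = (f ^^ n) u"
    have bU: "b \<in> U" using mapsn u by (simp add: b_def)
    have "(f ^^ n) (v - b) + (f ^^ n) b = (f ^^ n) v"
      using addn[of "v - b" b] subspace_diff[OF U(1) v bU] bU by simp
    then have "(f ^^ n) (v - b) = 0" using u by (simp add: b_def funpow_add)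
    moreover have "b \<in> (f ^^ m) ` U" for m
    proof -
      have "b \<in> Im (m + n)" using stable[of m] u by (auto simp: Im_def b_def)
      also have "Im (m + n) \<subseteq> Im m" using Im_anti[of n m] by (simp add: add.commute)
      finally show ?thesis by (simp add: Im_def)
    qed
    ultimately show "\<exists>a\<in>U. \<exists>b. v = a + b \<and> (f ^^ n) a = 0 \<and> (\<forall>m. b \<in> (f ^^ m) ` U)"
      using subspace_diff[OF U(1) v bU] by (intro bexI[of _ "v - b"] exI[of _ b]) auto
  next
    fix v m assume "v \<in> (f ^^ n) ` U" "(f ^^ m) v = 0"
    then obtain u where u: "u \<in> U" "v = (f ^^ n) u" by auto
    have "u \<in> Ker (m + n)" using u \<open>(f ^^ m) v = 0\<close> by (simp add: Ker_def funpow_add)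
    then have "u \<in> Ker n" using stable by blast
    then show "v = 0" using u by (simp add: Ker_def)
  qed
qed

text \<open>The usual argument for the independence of eigenvectors, relative to a stable subspace \<open>V\<close>: the
  case \<open>V = {0}\<close> is independence itself, and for a submodule \<open>V\<close> and weight vectors it says that
  submodules contain the weight components of their elements.\<close>

lemma joint_eigenvectors_in_subspace:
  fixes T :: "'e \<Rightarrow> 'b \<Rightarrow> 'b" and \<chi> :: "'i \<Rightarrow> 'e \<Rightarrow> 'a"
  assumes add: "\<And>e v w. e \<in> E \<Longrightarrow> T e (v + w) = T e v + T e w"
    and V: "subspace V" "\<And>e v. e \<in> E \<Longrightarrow> v \<in> V \<Longrightarrow> T e v \<in> V"
    and scale: "\<And>e c v. e \<in> E \<Longrightarrow> T e (c *s v) = c *s T e v"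
    and "finite F"
    and sep: "\<And>i j. i \<in> F \<Longrightarrow> j \<in> F \<Longrightarrow> i \<noteq> j \<Longrightarrow> \<exists>e\<in>E. \<chi> i e \<noteq> \<chi> j e"
    and eig: "\<And>i e. i \<in> F \<Longrightarrow> e \<in> E \<Longrightarrow> T e (w i) = \<chi> i e *s w i"
    and "(\<Sum>i\<in>F. w i) \<in> V" and "i \<in> F"
  shows "w i \<in> V"
proof -
  have T0: "T e 0 = 0" if "e \<in> E" for e
    using scale[OF that, of 0 0] by simp
  have Tsum: "T e (\<Sum>i\<in>F. u i) = (\<Sum>i\<in>F. T e (u i))" if "e \<in> E" for e F and u :: "'i \<Rightarrow> 'b"
    by (induction F rule: infinite_finite_induct) (auto simp: T0 add that)
  have "\<forall>i\<in>F. w i \<in> V"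
    using \<open>finite F\<close> sep eig \<open>(\<Sum>i\<in>F. w i) \<in> V\<close>
  proof (induction F arbitrary: w rule: finite_induct)
    case empty
    then show ?case by simp
  next
    case (insert a F)
    define s where "s = (\<Sum>i\<in>insert a F. w i)"
    have wV: "w j \<in> V" if j: "j \<in> F" for j
    proof -
      have "j \<noteq> a" using j insert.hyps by auto
      then obtain e where e: "e \<in> E" "\<chi> j e \<noteq> \<chi> a e"
        using insert.prems(1)[of j a] j by auto
      \<comment> \<open>This combination kills the summand \<open>w a\<close> and rescales the others, so it is the point where the
        induction hypothesis applies.\<close>
      have "T e s - \<chi> a e *s s = (\<Sum>i\<in>F. (\<chi> i e - \<chi> a e) *s w i)"
        unfolding s_def using insert.hyps e insert.prems(2)
        by (simp add: Tsum add scale_right_distrib scale_left_diff_distrib sum_subtractf scale_sum_right)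
      moreover have "T e s - \<chi> a e *s s \<in> V"
        using insert.prems(3) V e by (auto simp: s_def intro!: subspace_diff subspace_scale)
      moreover have "T e' ((\<chi> i e - \<chi> a e) *s w i) = \<chi> i e' *s (\<chi> i e - \<chi> a e) *s w i"
        if "i \<in> F" "e' \<in> E" for i e'
        using that insert.prems(2) by (simp add: scale scale_left_commute mult.commute)
      ultimately have "\<forall>i\<in>F. (\<chi> i e - \<chi> a e) *s w i \<in> V"
        using insert.prems(1) by (intro insert.IH) auto
      with j have "(\<chi> j e - \<chi> a e) *s w j \<in> V" by blast
      then have "(1 / (\<chi> j e - \<chi> a e)) *s (\<chi> j e - \<chi> a e) *s w j \<in> V"
        by (rule subspace_scale[OF V(1)])
      then show ?thesis using e by simp
    qed
    moreover have "w a = s - (\<Sum>i\<in>F. w i)" using insert.hyps by (simp add: s_def)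
    ultimately have "w a \<in> V"
      using insert.prems(3) V by (auto simp: s_def intro!: subspace_diff subspace_sum)
    then show ?case using wV by auto
  qed
  then show ?thesis using \<open>i \<in> F\<close> by auto
qed

lemma span_Union_subspaces_sum:
  assumes N: "\<And>j. j \<in> J \<Longrightarrow> subspace (N j)" and v: "v \<in> span (\<Union>j\<in>J. N j)"
  shows "\<exists>f. finite {j. f j \<noteq> 0} \<and> (\<forall>j\<in>J. f j \<in> N j) \<and> (\<forall>j. j \<notin> J \<longrightarrow> f j = 0) \<and>
             v = (\<Sum>j | f j \<noteq> 0. f j)"
  using v
proof (induction rule: span_induct_alt)
  case base
  show ?case using subspace_0[OF N] by (intro exI[of _ "\<lambda>_. 0"]) auto
next
  case (step c x y)
  then obtain f k where f: "finite {j. f j \<noteq> 0}" "\<forall>j\<in>J. f j \<in> N j" "\<forall>j. j \<notin> J \<longrightarrow> f j = 0"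
      "y = (\<Sum>j | f j \<noteq> 0. f j)" and k: "k \<in> J" "x \<in> N k"
    by auto
  define g where "g = f(k := c *s x + f k)"
  define F where "F = insert k {j. f j \<noteq> 0}"
  have F: "finite F" "k \<in> F" using f by (auto simp: F_def)
  have sub: "{j. g j \<noteq> 0} \<subseteq> F" by (auto simp: g_def F_def)
  have "(\<Sum>j | g j \<noteq> 0. g j) = (\<Sum>j\<in>F. g j)"
    using F sub by (intro sum.mono_neutral_left) auto
  also have "\<dots> = c *s x + f k + (\<Sum>j\<in>F - {k}. f j)"
    using F by (subst sum.remove[of F k]) (auto simp: g_def)
  also have "\<dots> = c *s x + (\<Sum>j\<in>F. f j)"
    using sum.remove[OF F, of f] by (simp add: add.assoc)
  also have "(\<Sum>j\<in>F. f j) = y"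
    unfolding f(4) using F by (intro sum.mono_neutral_right) (auto simp: F_def)
  finally have "c *s x + y = (\<Sum>j | g j \<noteq> 0. g j)" by simp
  moreover have "\<forall>j\<in>J. g j \<in> N j"
    using f k N by (auto simp: g_def intro!: subspace_add subspace_scale)
  moreover have "finite {j. g j \<noteq> 0}" using sub F finite_subset by blast
  ultimately show ?case using f k by (intro exI[of _ g]) (auto simp: g_def)
qed

lemma direct_sumI:
  assumes V: "subspace V" and N: "\<And>j. j \<in> J \<Longrightarrow> subspace (N j)" "\<And>j. j \<in> J \<Longrightarrow> N j \<subseteq> V"
    and spans: "V \<subseteq> span (\<Union>j\<in>J. N j)"
    and indep: "\<And>F f j. finite F \<Longrightarrow> F \<subseteq> J \<Longrightarrow> (\<And>j. j \<in> F \<Longrightarrow> f j \<in> N j) \<Longrightarrow> (\<Sum>j\<in>F. f j) = 0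
                  \<Longrightarrow> j \<in> F \<Longrightarrow> f j = 0"
  shows "direct_sum V J N"
proof -
  have unique: "f = g"
    if f: "finite {j. f j \<noteq> 0}" "\<forall>j\<in>J. f j \<in> N j" "\<forall>j. j \<notin> J \<longrightarrow> f j = 0"
      and g: "finite {j. g j \<noteq> 0}" "\<forall>j\<in>J. g j \<in> N j" "\<forall>j. j \<notin> J \<longrightarrow> g j = 0"
      and eq: "(\<Sum>j | f j \<noteq> 0. f j) = (\<Sum>j | g j \<noteq> 0. g j)" for f g
  proof
    fix j
    define F where "F = {j. f j \<noteq> 0} \<union> {j. g j \<noteq> 0}"
    have F: "finite F" "F \<subseteq> J" using f g by (auto simp: F_def)
    have "(\<Sum>j\<in>F. f j) = (\<Sum>j | f j \<noteq> 0. f j)" "(\<Sum>j\<in>F. g j) = (\<Sum>j | g j \<noteq> 0. g j)"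
      using F by (auto simp: F_def intro!: sum.mono_neutral_right)
    then have "(\<Sum>j\<in>F. f j - g j) = 0" using eq by (simp add: sum_subtractf)
    moreover have "f j - g j \<in> N j" if "j \<in> F" for j
      using that F(2) f(2) g(2) N(1) by (blast intro: subspace_diff)
    ultimately have "f j - g j = 0" if "j \<in> F"
      using indep[OF F, of "\<lambda>j. f j - g j"] that by blast
    moreover have "f j = 0 \<and> g j = 0" if "j \<notin> F" using that by (simp add: F_def)
    ultimately show "f j = g j" by (metis eq_iff_diff_eq_0)
  qed
  have "\<exists>!f. finite {j. f j \<noteq> 0} \<and> (\<forall>j\<in>J. f j \<in> N j) \<and> (\<forall>j. j \<notin> J \<longrightarrow> f j = 0) \<and>
             v = (\<Sum>j | f j \<noteq> 0. f j)" if "v \<in> V" for v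
  proof (rule ex_ex1I)
    show "\<exists>f. finite {j. f j \<noteq> 0} \<and> (\<forall>j\<in>J. f j \<in> N j) \<and> (\<forall>j. j \<notin> J \<longrightarrow> f j = 0) \<and>
             v = (\<Sum>j | f j \<noteq> 0. f j)"
    proof (rule span_Union_subspaces_sum)
      show "v \<in> span (\<Union>j\<in>J. N j)" using spans that by (rule subsetD)
    qed (rule N(1))
  next
    fix f g
    assume *: "finite {j. f j \<noteq> 0} \<and> (\<forall>j\<in>J. f j \<in> N j) \<and> (\<forall>j. j \<notin> J \<longrightarrow> f j = 0) \<and>
             v = (\<Sum>j | f j \<noteq> 0. f j)"
      "finite {j. g j \<noteq> 0} \<and> (\<forall>j\<in>J. g j \<in> N j) \<and> (\<forall>j. j \<notin> J \<longrightarrow> g j = 0) \<and>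
             v = (\<Sum>j | g j \<noteq> 0. g j)"
    from *(1)[THEN conjunct2, THEN conjunct2, THEN conjunct2]
      *(2)[THEN conjunct2, THEN conjunct2, THEN conjunct2]
    have "(\<Sum>j | f j \<noteq> 0. f j) = (\<Sum>j | g j \<noteq> 0. g j)" by (rule trans[OF sym])
    with * show "f = g" by (elim conjE) (rule unique)
  qed
  with V N show ?thesis
    unfolding direct_sum_def by (intro conjI ballI) assumption+
qed

definition component :: "'i set \<Rightarrow> ('i \<Rightarrow> 'b set) \<Rightarrow> 'i \<Rightarrow> 'b \<Rightarrow> 'b" where
  "component J N j v = (THE f. finite {j. f j \<noteq> 0} \<and> (\<forall>j\<in>J. f j \<in> N j) \<and>
     (\<forall>j. j \<notin> J \<longrightarrow> f j = 0) \<and> v = (\<Sum>j | f j \<noteq> 0. f j)) j"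

end

(* The context is reopened so that the plain name component denotes the local constant and not its
   instance for real vector spaces. *)
context vector_space
begin

context
  fixes J :: "'i set" and N :: "'i \<Rightarrow> 'b set"
  assumes ds: "direct_sum UNIV J N"
begin

lemma direct_sum_subspace: "j \<in> J \<Longrightarrow> subspace (N j)"
  using ds by (simp add: direct_sum_def)

lemma component:
  shows finite_component: "finite {j. component J N j v \<noteq> 0}"
    and component_mem: "j \<in> J \<Longrightarrow> component J N j v \<in> N j"
    and component_outside: "j \<notin> J \<Longrightarrow> component J N j v = 0"
    and sum_component: "v = (\<Sum>j | component J N j v \<noteq> 0. component J N j v)"
proof -
  let ?P = "\<lambda>f. finite {j. f j \<noteq> 0} \<and> (\<forall>j\<in>J. f j \<in> N j) \<and> (\<forall>j. j \<notin> J \<longrightarrow> f j = 0) \<and>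
                v = (\<Sum>j | f j \<noteq> 0. f j)"
  have "\<exists>!f. ?P f" using ds by (simp add: direct_sum_def)
  then have "?P (THE f. ?P f)" by (rule theI')
  then have P: "?P (\<lambda>j. component J N j v)" unfolding component_def .
  note c = P[THEN conjunct2]
  show "finite {j. component J N j v \<noteq> 0}" by (rule P[THEN conjunct1])
  show "component J N j v \<in> N j" if "j \<in> J" using c[THEN conjunct1] that by (rule bspec)
  show "component J N j v = 0" if "j \<notin> J"
    using c[THEN conjunct2, THEN conjunct1] that by blast
  show "v = (\<Sum>j | component J N j v \<noteq> 0. component J N j v)"
    by (rule c[THEN conjunct2, THEN conjunct2])
qed

lemma component_eqI:
  assumes F: "finite F" "\<And>i. i \<notin> F \<Longrightarrow> f i = 0" and f: "\<And>i. i \<in> J \<Longrightarrow> f i \<in> N i"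
    "\<And>i. i \<notin> J \<Longrightarrow> f i = 0" and v: "v = (\<Sum>i\<in>F. f i)"
  shows "component J N j v = f j"
proof -
  let ?P = "\<lambda>f. finite {j. f j \<noteq> 0} \<and> (\<forall>j\<in>J. f j \<in> N j) \<and> (\<forall>j. j \<notin> J \<longrightarrow> f j = 0) \<and>
                v = (\<Sum>j | f j \<noteq> 0. f j)"
  have sub: "{j. f j \<noteq> 0} \<subseteq> F" using F by auto
  have "(\<Sum>i\<in>F. f i) = (\<Sum>j | f j \<noteq> 0. f j)"
    using F sub by (intro sum.mono_neutral_right) auto
  then have "?P f" using assms sub finite_subset by auto
  moreover have "\<exists>!f. ?P f" using ds by (simp add: direct_sum_def)
  ultimately have "(THE f. ?P f) = f" by (rule the1_equality[rotated])
  then show ?thesis by (simp add: component_def)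
qed

lemma sum_component_superset:
  assumes "finite F" and "\<And>j. component J N j v \<noteq> 0 \<Longrightarrow> j \<in> F"
  shows "(\<Sum>j\<in>F. component J N j v) = v"
proof -
  have "(\<Sum>j\<in>F. component J N j v) = (\<Sum>j | component J N j v \<noteq> 0. component J N j v)"
    using assms by (intro sum.mono_neutral_right) auto
  also have "\<dots> = v" by (rule sum_component[symmetric])
  finally show ?thesis .
qed

lemma component_add: "component J N j (v + w) = component J N j v + component J N j w"
proof -
  let ?F = "{j. component J N j v \<noteq> 0} \<union> {j. component J N j w \<noteq> 0}"
  have "(\<Sum>j\<in>?F. component J N j v) = v" "(\<Sum>j\<in>?F. component J N j w) = w"
    using finite_component by (auto intro!: sum_component_superset)
  then show ?thesis
    using finite_component
    by (intro component_eqI[where F = ?F])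
       (auto simp: sum.distrib component_outside intro!: subspace_add direct_sum_subspace component_mem)
qed

text \<open>The additive maps for which this is used below are scalar multiplications, the action of a Lie
  algebra, and endomorphisms that preserve the summands.\<close>

lemma component_commute:
  assumes add: "\<And>v w. T (v + w) = T v + T w" and T: "\<And>j v. j \<in> J \<Longrightarrow> v \<in> N j \<Longrightarrow> T v \<in> N j"
  shows "component J N j (T v) = T (component J N j v)"
proof -
  have T0: "T 0 = 0" using add[of 0 0] by simp
  have Tsum: "T (sum f F) = (\<Sum>i\<in>F. T (f i))" for f :: "'i \<Rightarrow> 'b" and F
    by (induction F rule: infinite_finite_induct) (auto simp: T0 add)
  have "T v = (\<Sum>j | component J N j v \<noteq> 0. T (component J N j v))"
    using Tsum sum_component[of v] by metis
  then show ?thesis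
    using finite_component
    by (intro component_eqI) (auto simp: T0 component_outside component_mem T)
qed

lemma component_scale: "component J N j (c *s v) = c *s component J N j v"
  by (rule component_commute) (auto simp: scale_right_distrib direct_sum_subspace subspace_scale)

lemma component_self:
  assumes "j \<in> J" and "v \<in> N j"
  shows "component J N i v = (if i = j then v else 0)"
  using assms
  by (intro component_eqI[where F = "{j}"]) (auto simp: subspace_0 direct_sum_subspace)

end

text \<open>The elements of a finite spanning set of \<open>U\<close> have altogether only finitely many non-zero
  components.\<close>

lemma finite_summands_meeting_fin_dim:
  assumes ds: "direct_sum UNIV J N" and U: "fin_dim U"
  shows "finite {j \<in> J. \<exists>v\<in>N j \<inter> U. v \<noteq> 0}"
proof -
  from U obtain B where B: "finite B" "U \<subseteq> span B" by (auto simp: fin_dim_def)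
  define F where "F = (\<Union>b\<in>B. {j. component J N j b \<noteq> 0})"
  have "component J N j v = 0" if "v \<in> span B" "j \<notin> F" for j v
    using that
  proof (induction rule: span_induct_alt)
    case base
    show ?case using component_scale[OF ds, of j 0 0] by simp
  next
    case (step c x y)
    then show ?case by (auto simp: component_add[OF ds] component_scale[OF ds] F_def)
  qed
  then have "{j \<in> J. \<exists>v\<in>N j \<inter> U. v \<noteq> 0} \<subseteq> F"
    using B component_self[OF ds] by fastforce
  moreover have "finite F" using B finite_component[OF ds] by (auto simp: F_def)
  ultimately show ?thesis by (rule finite_subset)
qed

text \<open>By induction on the dimension: an idempotent of \<open>E\<close> that is neither \<open>0\<close> nor \<open>1\<close> on \<open>V\<close> splits \<open>V\<close>
  into two smaller subspaces, which are stable under \<open>E\<close> because the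
  elements of \<open>E\<close> commute.\<close>

lemma commuting_idempotents_joint_eigenvectors:
  assumes lin: "\<And>e v w. e \<in> E \<Longrightarrow> e (v + w) = e v + e w" "\<And>e c v. e \<in> E \<Longrightarrow> e (c *s v) = c *s e v"
    and idem: "\<And>e v. e \<in> E \<Longrightarrow> e (e v) = e v"
    and comm: "\<And>e e' v. e \<in> E \<Longrightarrow> e' \<in> E \<Longrightarrow> e (e' v) = e' (e v)"
    and V: "subspace V" "fin_dim V" "\<And>e v. e \<in> E \<Longrightarrow> v \<in> V \<Longrightarrow> e v \<in> V"
  shows "V \<subseteq> span (\<Union>S\<in>Pow E. joint_eigenspace E S)"
  using V
proof (induction "dim V" arbitrary: V rule: less_induct)
  case less
  show ?case
  proof (cases "\<exists>e\<in>E. \<exists>v\<in>V. \<exists>w\<in>V. e v \<noteq> v \<and> e w \<noteq> 0")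
    case True
    then obtain e v w where e: "e \<in> E" "v \<in> V" "e v \<noteq> v" "w \<in> V" "e w \<noteq> 0" by auto
    define P where "P = {x \<in> V. e x = x}"
    define Q where "Q = {x \<in> V. e x = 0}"
    have e0: "e 0 = 0" using lin(2)[OF e(1), of 0 0] by simp
    have ediff: "e (x - y) = e x - e y" for x y
      using lin(1)[OF e(1), of "x - y" y] by (simp add: algebra_simps)
    have sub: "subspace P" "subspace Q"
      using less.prems(1) e0 by (auto simp: P_def Q_def subspace_def lin[OF e(1)])
    have "P \<subset> V" "Q \<subset> V" using e by (auto simp: P_def Q_def)
    then have "dim P < dim V" "dim Q < dim V"
      using sub less.prems by (auto intro!: subspace_dim_strict_mono)
    moreover have "fin_dim P" "fin_dim Q"
      using less.prems by (auto simp: P_def Q_def intro: fin_dim_subset)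
    moreover have "e' x \<in> P" if "e' \<in> E" "x \<in> P" for e' x
      using that less.prems(3) comm[of e e' x] e by (auto simp: P_def)
    moreover have "e' x \<in> Q" if "e' \<in> E" "x \<in> Q" for e' x
      using that less.prems(3) comm[of e e' x] e lin(2)[of e' 0 0] by (auto simp: Q_def)
    ultimately have span: "P \<subseteq> span (\<Union>S\<in>Pow E. joint_eigenspace E S)"
      "Q \<subseteq> span (\<Union>S\<in>Pow E. joint_eigenspace E S)"
      using less.hyps sub by blast+
    show ?thesis
    proof
      fix x assume "x \<in> V"
      then have "e x \<in> P" "x - e x \<in> Q"
        using less.prems idem[OF e(1)] e by (auto simp: P_def Q_def ediff subspace_diff)
      then have "e x + (x - e x) \<in> span (\<Union>S\<in>Pow E. joint_eigenspace E S)"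
        using span by (intro span_add) blast+
      then show "x \<in> span (\<Union>S\<in>Pow E. joint_eigenspace E S)" by simp
    qed
  next
    case False
    let ?S = "{e \<in> E. \<forall>v\<in>V. e v = v}"
    have "e v = (if e \<in> ?S then v else 0)" if "e \<in> E" "v \<in> V" for e v
      using False that by auto
    then have "V \<subseteq> (\<Union>S\<in>Pow E. joint_eigenspace E S)"
      by (intro subsetI UN_I[of ?S]) (auto simp: joint_eigenspace_def)
    then show ?thesis using span_superset by blast
  qed
qed

end

text \<open>A shortest linear relation between \<open>u, f u, f (f u), \<dots>\<close> is \<open>p(f) u = 0\<close> for a non-constant polynomial
  \<open>p = (X - c) q\<close>; by minimality \<open>q(f) u\<close> is non-zero, and it is an eigenvector for \<open>c\<close>.\<close>

lemma eigenvector_exists: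
  fixes scale :: "'k::alg_closed_field \<Rightarrow> 'b::ab_group_add \<Rightarrow> 'b" (infixr \<open>*s\<close> 75)
  assumes "vector_space scale" and U: "module.subspace scale U" "vector_space.fin_dim scale U" "U \<noteq> {0}"
    and add: "\<And>v w. v \<in> U \<Longrightarrow> w \<in> U \<Longrightarrow> f (v + w) = f v + f w"
    and scale: "\<And>c v. v \<in> U \<Longrightarrow> f (c *s v) = c *s f v"
    and maps: "\<And>v. v \<in> U \<Longrightarrow> f v \<in> U"
  shows "\<exists>c. \<exists>w\<in>U. w \<noteq> 0 \<and> f w = c *s w"
proof -
  interpret vector_space scale by fact
  obtain u where u: "u \<in> U" "u \<noteq> 0" using U subspace_0 by blast
  obtain B where B: "finite B" "U \<subseteq> span B" using U by (auto simp: fin_dim_def)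
  have fU: "(f ^^ i) u \<in> U" for i using u maps by (induction i) auto
  have f0: "f 0 = 0" using scale[of 0 0] U subspace_0 by simp
  define ev where "ev x n = (\<Sum>i\<le>n. x i *s (f ^^ i) u)" for x and n :: nat
  have evU: "ev x n \<in> U" for x n
    using U fU by (auto simp: ev_def intro!: subspace_sum subspace_scale)
  define dep where "dep n \<longleftrightarrow> (\<exists>x. (\<exists>i\<le>n. x i \<noteq> 0) \<and> ev x n = 0)" for n
  have "dep (card B)"
  proof -
    have "\<forall>i. \<exists>a. (f ^^ i) u = (\<Sum>b\<in>B. a b *s b)"
      using fU B span_finite[OF B(1)] by blast
    then obtain a where a: "\<And>i. (f ^^ i) u = (\<Sum>b\<in>B. a i b *s b)" by metis
    obtain x where x: "\<exists>i\<in>{..card B}. x i \<noteq> 0" "\<forall>b\<in>B. (\<Sum>i\<in>{..card B}. a i b * x i) = 0"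
      using homogeneous_system_nontrivial_solution[OF B(1), of "{..card B}" "\<lambda>b i. a i b"] by auto
    have "ev x (card B) = (\<Sum>i\<le>card B. \<Sum>b\<in>B. (x i * a i b) *s b)"
      unfolding ev_def a by (simp add: scale_sum_right)
    also have "\<dots> = (\<Sum>b\<in>B. (\<Sum>i\<le>card B. a i b * x i) *s b)"
      by (subst sum.swap) (simp add: scale_sum_left mult.commute)
    also have "\<dots> = 0" using x by simp
    finally show ?thesis using x by (auto simp: dep_def)
  qed
  then obtain n where n: "dep n" "\<And>m. m < n \<Longrightarrow> \<not> dep m"
    using exists_least_iff[of dep] by blast
  obtain x where x: "\<exists>i\<le>n. x i \<noteq> 0" "ev x n = 0" using n by (auto simp: dep_def)
  have "n \<noteq> 0"
  proof
    assume "n = 0"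
    then show False using x u by (auto simp: ev_def)
  qed
  then obtain m where m: "n = Suc m" using not0_implies_Suc by blast
  have xn: "x n \<noteq> 0"
  proof
    assume "x n = 0"
    moreover from this have "ev x m = 0" using x by (simp add: ev_def m)
    ultimately show False using x n(2)[of m] unfolding dep_def m by (metis le_Suc_eq lessI)
  qed
  define p where "p = (\<Sum>i\<le>n. monom (x i) i)"
  have cp: "coeff p i = (if i \<le> n then x i else 0)" for i
    by (simp add: p_def coeff_sum)
  have "degree p = n"
    using xn by (intro antisym degree_le le_degree) (auto simp: cp)
  then obtain c where "poly p c = 0"
    using alg_closed_imp_poly_has_root[of p] m by auto
  then obtain q where q: "p = [:-c, 1:] * q"
    unfolding poly_eq_0_iff_dvd by (elim dvdE)
  have "q \<noteq> 0" using q \<open>degree p = n\<close> m by auto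
  then have dq: "degree q = m"
    using \<open>degree p = n\<close> m unfolding q by (subst (asm) degree_mult_eq) auto
  define w where "w = ev (coeff q) m"
  have "w \<noteq> 0"
    using n(2)[of m] \<open>q \<noteq> 0\<close> m dq unfolding dep_def w_def by (metis leading_coeff_0_iff lessI order_refl)
  have fsum: "f (\<Sum>i\<le>k. y i *s (f ^^ i) u) = (\<Sum>i\<le>k. y i *s (f ^^ Suc i) u)" for k y
  proof (induction k)
    case 0
    show ?case using u by (simp add: scale)
  next
    case (Suc k)
    have "(\<Sum>i\<le>k. y i *s (f ^^ i) u) \<in> U" using evU[of y k] by (simp add: ev_def)
    moreover have "y (Suc k) *s (f ^^ Suc k) u \<in> U" by (rule subspace_scale[OF U(1) fU])
    ultimately have "f (\<Sum>i\<le>Suc k. y i *s (f ^^ i) u)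
        = f (\<Sum>i\<le>k. y i *s (f ^^ i) u) + f (y (Suc k) *s (f ^^ Suc k) u)"
      by (simp add: add)
    then show ?case using Suc scale[OF fU, of "y (Suc k)" "Suc k"] by simp
  qed
  have shift: "x 0 = - c * coeff q 0" "\<And>i. i \<le> m \<Longrightarrow> x (Suc i) = coeff q i - c * coeff q (Suc i)"
    using cp[of 0] cp[of "Suc i" for i] m unfolding q by auto
  have "0 = x 0 *s u + (\<Sum>i\<le>m. x (Suc i) *s (f ^^ Suc i) u)"
    using x by (simp add: ev_def m sum.atMost_Suc_shift del: sum.atMost_Suc)
  also have "(\<Sum>i\<le>m. x (Suc i) *s (f ^^ Suc i) u)
      = (\<Sum>i\<le>m. coeff q i *s (f ^^ Suc i) u) - c *s (\<Sum>i\<le>m. coeff q (Suc i) *s (f ^^ Suc i) u)"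
    by (simp add: shift scale_left_diff_distrib sum_subtractf scale_sum_right)
  also have "(\<Sum>i\<le>m. coeff q i *s (f ^^ Suc i) u) = f w"
    by (simp only: w_def ev_def fsum)
  also have "x 0 *s u + (f w - c *s (\<Sum>i\<le>m. coeff q (Suc i) *s (f ^^ Suc i) u))
      = f w - c *s (\<Sum>i\<le>Suc m. coeff q i *s (f ^^ i) u)"
    by (simp add: sum.atMost_Suc_shift shift scale_right_distrib del: sum.atMost_Suc)
  also have "(\<Sum>i\<le>Suc m. coeff q i *s (f ^^ i) u) = w"
    using dq by (simp add: w_def ev_def coeff_eq_0)
  finally show ?thesis using \<open>w \<noteq> 0\<close> evU by (intro exI[of _ c] bexI[of _ w]) (auto simp: w_def)
qed

text \<open>Reduces the matching of summands to the comparison of finite multiplicities, with isomorphism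
  classes as the values of \<open>c\<close> and \<open>d\<close>.\<close>

lemma bij_betw_of_equinumerous_fibres:
  assumes fin: "\<And>x. finite {i \<in> I. c i = x}" "\<And>x. finite {k \<in> K. d k = x}"
    and card: "\<And>x. card {i \<in> I. c i = x} = card {k \<in> K. d k = x}"
  shows "\<exists>\<psi>. bij_betw \<psi> I K \<and> (\<forall>i\<in>I. d (\<psi> i) = c i)"
proof -
  have "\<forall>x. \<exists>\<beta>. bij_betw \<beta> {i \<in> I. c i = x} {k \<in> K. d k = x}"
    using fin card by (simp add: finite_same_card_bij)
  then obtain \<beta> where \<beta>: "\<And>x. bij_betw (\<beta> x) {i \<in> I. c i = x} {k \<in> K. d k = x}"
    by metis
  define \<psi> where "\<psi> i = \<beta> (c i) i" for i
  have \<psi>: "\<psi> i \<in> K" "d (\<psi> i) = c i" if "i \<in> I" for i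
    using bij_betwE[OF \<beta>[of "c i"]] that by (auto simp: \<psi>_def)
  have "inj_on \<psi> I"
  proof (rule inj_onI)
    fix i j assume ij: "i \<in> I" "j \<in> I" "\<psi> i = \<psi> j"
    then have "c i = c j" using \<psi>(2) by metis
    then show "i = j"
      using ij \<beta>[of "c j"] unfolding \<psi>_def bij_betw_def inj_on_def by auto
  qed
  moreover have "K \<subseteq> \<psi> ` I"
  proof
    fix k assume "k \<in> K"
    then have "k \<in> \<beta> (d k) ` {i \<in> I. c i = d k}" using \<beta>[of "d k"] by (auto simp: bij_betw_def)
    then obtain i where "i \<in> I" "c i = d k" "k = \<beta> (d k) i" by blast
    then have "k = \<psi> i" by (simp add: \<psi>_def)
    with \<open>i \<in> I\<close> show "k \<in> \<psi> ` I" by blast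
  qed
  ultimately show ?thesis using \<psi> by (intro exI[of _ \<psi>]) (auto simp: bij_betw_def)
qed

context lie_module
begin

section \<open>Homomorphisms\<close>

text \<open>Homomorphisms between submodules are total functions on the ambient type; only the values on
  the source matter, so restricting the source needs no change of the function.\<close>

definition hom :: "'m set \<Rightarrow> 'm set \<Rightarrow> ('m \<Rightarrow> 'm) \<Rightarrow> bool" where
  "hom V W f \<longleftrightarrow> (\<forall>v\<in>V. f v \<in> W) \<and> (\<forall>v\<in>V. \<forall>w\<in>V. f (v + w) = f v + f w) \<and>
     (\<forall>c. \<forall>v\<in>V. f (c *m v) = c *m f v) \<and> (\<forall>x. \<forall>v\<in>V. f (act x v) = act x (f v))"

lemma homI:
  assumes "\<And>v. v \<in> V \<Longrightarrow> f v \<in> W" "\<And>v w. v \<in> V \<Longrightarrow> w \<in> V \<Longrightarrow> f (v + w) = f v + f w"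
    "\<And>c v. v \<in> V \<Longrightarrow> f (c *m v) = c *m f v" "\<And>x v. v \<in> V \<Longrightarrow> f (act x v) = act x (f v)"
  shows "hom V W f"
  using assms by (simp add: hom_def)

lemma homD:
  assumes "hom V W f" and "v \<in> V"
  shows hom_mem: "f v \<in> W" and hom_add: "w \<in> V \<Longrightarrow> f (v + w) = f v + f w"
    and hom_scale: "f (c *m v) = c *m f v" and hom_act: "f (act x v) = act x (f v)"
  using assms by (auto simp: hom_def)

lemma submoduleD:
  assumes "submodule V"
  shows submodule_subspace: "M.subspace V" and submodule_zero: "0 \<in> V"
    and submodule_add: "v \<in> V \<Longrightarrow> w \<in> V \<Longrightarrow> v + w \<in> V"
    and submodule_diff: "v \<in> V \<Longrightarrow> w \<in> V \<Longrightarrow> v - w \<in> V"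
    and submodule_scale: "v \<in> V \<Longrightarrow> c *m v \<in> V"
    and submodule_act: "v \<in> V \<Longrightarrow> act x v \<in> V"
    and submodule_sum: "(\<And>i. i \<in> F \<Longrightarrow> g i \<in> V) \<Longrightarrow> sum g F \<in> V"
  using assms
  by (auto simp: submodule_def M.subspace_0 M.subspace_add M.subspace_diff M.subspace_scale M.subspace_sum)

lemma submoduleI:
  assumes "0 \<in> V" "\<And>v w. v \<in> V \<Longrightarrow> w \<in> V \<Longrightarrow> v + w \<in> V" "\<And>c v. v \<in> V \<Longrightarrow> c *m v \<in> V"
    "\<And>x v. v \<in> V \<Longrightarrow> act x v \<in> V"
  shows "submodule V"
  using assms by (auto simp: submodule_def M.subspace_def)

lemma submodule_UNIV: "submodule UNIV"
  by (rule submoduleI) auto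

lemma act_zero [simp]: "act x 0 = 0"
  using act_add_right[of x 0 0] by simp

lemma act_diff: "act x (v - w) = act x v - act x w"
  using act_add_right[of x "v - w" w] by (simp add: algebra_simps)

lemma hom_zero:
  assumes "submodule V" "hom V W f"
  shows "f 0 = 0"
  using hom_scale[OF assms(2) submodule_zero[OF assms(1)], of 0] by simp

lemma hom_diff:
  assumes "submodule V" "hom V W f" "v \<in> V" "w \<in> V"
  shows "f (v - w) = f v - f w"
  using hom_add[OF assms(2) submodule_diff[OF assms(1,3,4)] assms(4)] by (simp add: algebra_simps)

lemma hom_sum:
  assumes "submodule V" "hom V W f" "\<And>i. i \<in> F \<Longrightarrow> g i \<in> V"
  shows "f (\<Sum>i\<in>F. g i) = (\<Sum>i\<in>F. f (g i))"
  using assms(3)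
  by (induction F rule: infinite_finite_induct)
     (auto simp: hom_zero[OF assms(1,2)] hom_add[OF assms(2)] submodule_sum[OF assms(1)])

lemma hom_comp: "hom U V f \<Longrightarrow> hom V W g \<Longrightarrow> hom U W (\<lambda>v. g (f v))"
  by (auto simp: hom_def)

lemma hom_subset: "hom V W f \<Longrightarrow> U \<subseteq> V \<Longrightarrow> W \<subseteq> W' \<Longrightarrow> hom U W' f"
  unfolding hom_def by blast

lemma hom_id: "hom V V (\<lambda>v. v)"
  by (auto simp: hom_def)

lemma hom_plus:
  assumes "submodule W" "hom V W f" "hom V W g"
  shows "hom V W (\<lambda>v. f v + g v)"
  using assms by (intro homI) (auto simp: homD submoduleD act_add_right M.scale_right_distrib algebra_simps)

lemma hom_minus:
  assumes "submodule W" "hom V W f" "hom V W g"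
  shows "hom V W (\<lambda>v. f v - g v)"
  using assms by (intro homI) (auto simp: homD submoduleD act_diff M.scale_right_diff_distrib algebra_simps)

lemma hom_scaled:
  assumes "submodule W" "hom V W f"
  shows "hom V W (\<lambda>v. c *m f v)"
  using assms
  by (intro homI) (auto simp: homD submoduleD act_scale_right M.scale_right_distrib M.scale_left_commute)

lemma hom_sum_fun:
  assumes W: "submodule W" and "\<And>i. i \<in> F \<Longrightarrow> hom V W (f i)"
  shows "hom V W (\<lambda>v. \<Sum>i\<in>F. f i v)"
  using assms(2)
proof (induction F rule: infinite_finite_induct)
  case (insert i F)
  then show ?case using hom_plus[OF W, of V "f i" "\<lambda>v. \<Sum>i\<in>F. f i v"] by simp
qed (auto intro!: homI simp: submodule_zero[OF W])

lemma hom_inv_into: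
  assumes V: "submodule V" and f: "hom V W f" and bij: "bij_betw f V W"
  shows "hom W V (inv_into V f)"
proof -
  have *: "inv_into V f w \<in> V" "f (inv_into V f w) = w" if "w \<in> W" for w
    using bij that by (auto simp: bij_betw_def inv_into_into f_inv_into_f)
  have eq: "inv_into V f w = v" if "v \<in> V" "f v = w" for v w
    using bij that by (auto simp: bij_betw_def)
  show ?thesis
    by (intro homI) (auto intro!: eq simp: * submoduleD[OF V] homD[OF f])
qed

lemma hom_funpow:
  assumes "hom V V f"
  shows "hom V V (f ^^ n)"
proof (induction n)
  case 0
  show ?case using hom_id by (simp add: id_def)
next
  case (Suc n)
  then show ?case using hom_comp[OF Suc assms] by (simp add: comp_def)
qed

lemma submodule_kernel:
  assumes "submodule V" "hom V W f"
  shows "submodule {v \<in> V. f v = 0}"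
  using assms by (intro submoduleI) (auto simp: submoduleD hom_zero homD)

lemma submodule_image:
  assumes V: "submodule V" and f: "hom V W f"
  shows "submodule (f ` V)"
proof (rule submoduleI)
  show "0 \<in> f ` V" using hom_zero[OF V f] submodule_zero[OF V] by (metis imageI)
next
  fix v w assume "v \<in> f ` V" "w \<in> f ` V"
  then show "v + w \<in> f ` V" using hom_add[OF f] submodule_add[OF V] by (metis (no_types, lifting) imageE imageI)
next
  fix c v assume "v \<in> f ` V"
  then show "c *m v \<in> f ` V" using hom_scale[OF f] submodule_scale[OF V] by (metis (no_types, lifting) imageE imageI)
next
  fix x v assume "v \<in> f ` V"
  then show "act x v \<in> f ` V" using hom_act[OF f] submodule_act[OF V] by (metis (no_types, lifting) imageE imageI)
qed

lemma hom_component: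
  assumes ds: "M.direct_sum UNIV J N" and N: "\<And>i. i \<in> J \<Longrightarrow> submodule (N i)" and "j \<in> J"
  shows "hom UNIV (N j) (M.component J N j)"
  using assms
  by (intro homI)
     (auto simp: M.component_mem M.component_add M.component_scale act_add_right submodule_act
        intro!: M.component_commute)

lemma isomorphic_iff_hom: "isomorphic V W \<longleftrightarrow> (\<exists>f. hom V W f \<and> bij_betw f V W)"
  unfolding isomorphic_def hom_def
  by (intro iff_exI) (blast dest: bij_betwE)

lemma isomorphic_refl: "isomorphic V V"
  unfolding isomorphic_iff_hom using hom_id by (auto intro!: exI[of _ "\<lambda>v. v"] simp: bij_betw_def)

lemma isomorphic_sym: "submodule V \<Longrightarrow> isomorphic V W \<Longrightarrow> isomorphic W V"
  unfolding isomorphic_iff_hom using hom_inv_into bij_betw_inv_into by blast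

lemma isomorphic_trans: "isomorphic U V \<Longrightarrow> isomorphic V W \<Longrightarrow> isomorphic U W"
  unfolding isomorphic_iff_hom using hom_comp bij_betw_trans[unfolded comp_def] by metis

lemma complementary_projection:
  assumes sub: "submodule A" "submodule B" and comp: "M.complementary V A B"
  obtains q where "hom V A q" "\<And>a. a \<in> A \<Longrightarrow> q a = a" "\<And>b. b \<in> B \<Longrightarrow> q b = 0"
proof -
  define q where "q v = (SOME a. a \<in> A \<and> v - a \<in> B)" for v
  have AB: "A \<inter> B = {0}" and V: "V = {a + b | a b. a \<in> A \<and> b \<in> B}"
    using comp by (auto simp: M.complementary_def)
  have ex: "q v \<in> A \<and> v - q v \<in> B" if "v \<in> V" for v
  proof -
    from that obtain a b where "a \<in> A" "b \<in> B" "v = a + b" unfolding V by blast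
    then have "a \<in> A \<and> v - a \<in> B" by simp
    then show ?thesis unfolding q_def by (rule someI)
  qed
  have eq: "q v = a" if "v \<in> V" "a \<in> A" "v - a \<in> B" for v a
  proof -
    have "q v - a \<in> A" using ex that sub by (auto intro: submodule_diff)
    moreover have "q v - a \<in> B" using submodule_diff[OF sub(2) that(3), of "v - q v"] ex that by simp
    ultimately have "q v - a = 0" using AB by blast
    then show ?thesis by simp
  qed
  have memV: "a + b \<in> V" if "a \<in> A" "b \<in> B" for a b using that V by blast
  have subV: "submodule V"
  proof (rule submoduleI)
    show "0 \<in> V" using memV[of 0 0] sub by (auto simp: submodule_zero)
  next
    fix v w assume vw: "v \<in> V" "w \<in> V"
    then have "(q v + q w) + ((v - q v) + (w - q w)) \<in> V"
      using ex sub by (intro memV submodule_add) auto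
    then show "v + w \<in> V" by (simp add: algebra_simps)
  next
    fix c v assume v: "v \<in> V"
    then have "c *m q v + c *m (v - q v) \<in> V" using ex sub by (intro memV submodule_scale) auto
    then show "c *m v \<in> V" by (simp add: M.scale_right_diff_distrib)
  next
    fix x v assume v: "v \<in> V"
    then have "act x (q v) + act x (v - q v) \<in> V" using ex sub by (intro memV submodule_act) auto
    then show "act x v \<in> V" by (simp add: act_diff)
  qed
  have "hom V A q"
  proof (rule homI)
    fix v w assume vw: "v \<in> V" "w \<in> V"
    then have "(v - q v) + (w - q w) \<in> B" using ex sub by (intro submodule_add) auto
    then show "q (v + w) = q v + q w"
      using vw ex sub by (intro eq) (auto simp: algebra_simps submodule_add[OF subV] submodule_add[OF sub(1)])
  next
    fix c v assume v: "v \<in> V"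
    then have "c *m (v - q v) \<in> B" using ex sub by (intro submodule_scale) auto
    then show "q (c *m v) = c *m q v"
      using v ex sub subV by (intro eq) (auto simp: M.scale_right_diff_distrib submodule_scale)
  next
    fix x v assume v: "v \<in> V"
    then have "act x (v - q v) \<in> B" using ex sub by (intro submodule_act) auto
    then show "q (act x v) = act x (q v)"
      using v ex sub subV by (intro eq) (auto simp: act_diff submodule_act)
  qed (use ex in auto)
  moreover have "q a = a" if "a \<in> A" for a
    using that memV[of a 0] sub by (intro eq) (auto simp: submodule_zero)
  moreover have "q b = 0" if "b \<in> B" for b
    using that memV[of 0 b] sub by (intro eq) (auto simp: submodule_zero)
  ultimately show ?thesis using that by blast
qed

text \<open>Indecomposability in terms of submodules alone; it is shown below to agree with
  indecomposability as an object, since every submodule of an object is an object.\<close>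

definition indecomposable :: "'m set \<Rightarrow> bool" where
  "indecomposable V \<longleftrightarrow> submodule V \<and> V \<noteq> {0} \<and>
     \<not> (\<exists>A B. submodule A \<and> submodule B \<and> A \<noteq> {0} \<and> B \<noteq> {0} \<and> M.complementary V A B)"

definition locally_nilpotent :: "'m set \<Rightarrow> ('m \<Rightarrow> 'm) \<Rightarrow> bool" where
  "locally_nilpotent V f \<longleftrightarrow> (\<forall>v\<in>V. \<exists>n. (f ^^ n) v = 0)"

lemma indecomposable_submodule: "indecomposable V \<Longrightarrow> submodule V"
  by (simp add: indecomposable_def)

lemma indecomposable_nonzero:
  assumes "indecomposable V"
  obtains v where "v \<in> V" "v \<noteq> 0"
  using assms submodule_zero[of V] by (auto simp: indecomposable_def)

end

section \<open>Modules with finite-dimensional weight spaces\<close>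

locale finite_weight_module = lie_module scale bracket scaleM act
  for scale :: "'k::alg_closed_field \<Rightarrow> 'g::ab_group_add \<Rightarrow> 'g" (infixr \<open>*s\<close> 75)
    and bracket :: "'g \<Rightarrow> 'g \<Rightarrow> 'g"
    and scaleM :: "'k \<Rightarrow> 'm::ab_group_add \<Rightarrow> 'm" (infixr \<open>*m\<close> 75)
    and act :: "'g \<Rightarrow> 'm \<Rightarrow> 'm" +
  fixes h :: "'g set"
  assumes weight_decomposition: "M.direct_sum UNIV (dual h) (weight_space h)"
    and weight_space_fin_dim: "\<mu> \<in> dual h \<Longrightarrow> M.fin_dim (weight_space h \<mu>)"
begin

abbreviation weight_component :: "('g \<Rightarrow> 'k) \<Rightarrow> 'm \<Rightarrow> 'm" where
  "weight_component \<equiv> M.component (dual h) (weight_space h)"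

lemmas weight_component_facts = M.component[OF weight_decomposition]

text \<open>Functionals in the dual of \<open>\<hh>\<close> are undefined outside \<open>\<hh>\<close>, so distinct ones already differ on
  \<open>\<hh>\<close>; weight vectors are then joint eigenvectors for the action of \<open>\<hh>\<close> to which the
  independence argument applies.\<close>

lemma submodule_weight_vectors:
  assumes V: "submodule V" and F: "finite F" "F \<subseteq> dual h"
    and w: "\<And>\<mu>. \<mu> \<in> F \<Longrightarrow> w \<mu> \<in> weight_space h \<mu>" and sum: "(\<Sum>\<mu>\<in>F. w \<mu>) \<in> V" and \<mu>: "\<mu> \<in> F"
  shows "w \<mu> \<in> V"
proof (rule M.joint_eigenvectors_in_subspace[where T = act and E = h and \<chi> = "\<lambda>\<mu>. \<mu>" and F = F])
  fix \<mu> \<nu> assume "\<mu> \<in> F" "\<nu> \<in> F" "\<mu> \<noteq> \<nu>"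
  then show "\<exists>H\<in>h. \<mu> H \<noteq> \<nu> H"
    using F by (auto simp: dual_def intro: extensionalityI)
next
  fix \<mu> H assume "\<mu> \<in> F" "H \<in> h"
  then show "act H (w \<mu>) = \<mu> H *m w \<mu>" using w by (simp add: weight_space_def)
qed (use V F sum \<mu> in \<open>auto simp: submoduleD act_add_right act_scale_right\<close>)

lemma weight_component_mem:
  assumes "submodule V" and "v \<in> V"
  shows "weight_component \<mu> v \<in> V"
proof (cases "weight_component \<mu> v = 0")
  case True
  then show ?thesis using assms by (simp add: submodule_zero)
next
  case False
  let ?F = "{\<mu>. weight_component \<mu> v \<noteq> 0}"
  have F: "?F \<subseteq> dual h" using weight_component_facts(3) by blast
  show ?thesis
  proof (rule submodule_weight_vectors[where F = ?F and w = "\<lambda>\<mu>. weight_component \<mu> v"])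
    show "(\<Sum>\<mu>\<in>?F. weight_component \<mu> v) \<in> V"
      using assms weight_component_facts(4)[symmetric, of v] by simp
  qed (use assms F False weight_component_facts(1,2) in auto)
qed

lemma weight_space_subspace: "M.subspace (weight_space h \<mu>)"
  by (auto simp: M.subspace_def weight_space_def act_add_right act_scale_right M.scale_right_distrib
      M.scale_left_commute)

lemma submodule_weight_decomposition:
  assumes V: "submodule V"
  shows "M.direct_sum V (dual h) (\<lambda>\<mu>. V \<inter> weight_space h \<mu>)"
proof (rule M.direct_sumI)
  show "V \<subseteq> M.span (\<Union>\<mu>\<in>dual h. V \<inter> weight_space h \<mu>)"
  proof
    fix v assume v: "v \<in> V"
    have "(\<Sum>\<mu> | weight_component \<mu> v \<noteq> 0. weight_component \<mu> v)
        \<in> M.span (\<Union>\<mu>\<in>dual h. V \<inter> weight_space h \<mu>)"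
    proof (intro M.span_sum M.span_base)
      fix \<mu> assume "\<mu> \<in> {\<mu>. weight_component \<mu> v \<noteq> 0}"
      then have "\<mu> \<in> dual h" using weight_component_facts(3) by blast
      then show "weight_component \<mu> v \<in> (\<Union>\<mu>\<in>dual h. V \<inter> weight_space h \<mu>)"
        using weight_component_mem[OF V v] weight_component_facts(2) by blast
    qed
    then show "v \<in> M.span (\<Union>\<mu>\<in>dual h. V \<inter> weight_space h \<mu>)"
      using weight_component_facts(4)[symmetric, of v] by simp
  qed
next
  fix F f \<mu>
  assume "finite F" "F \<subseteq> dual h" "\<And>\<mu>. \<mu> \<in> F \<Longrightarrow> f \<mu> \<in> V \<inter> weight_space h \<mu>"
    "(\<Sum>\<mu>\<in>F. f \<mu>) = 0" "\<mu> \<in> F"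
  moreover have "submodule {0}" by (rule submoduleI) auto
  ultimately show "f \<mu> = 0" using submodule_weight_vectors[of "{0}" F f \<mu>] by auto
qed (use V weight_space_subspace in \<open>auto simp: submodule_subspace M.subspace_inter\<close>)

text \<open>Of the conditions on an object, the weight decomposition passes to submodules as just shown, while
  finite-dimensionality and local finiteness are inherited trivially.\<close>

lemma category_O_bar_iff_submodule:
  assumes "category_O_bar b h UNIV"
  shows "category_O_bar b h V \<longleftrightarrow> submodule V"
  using assms submodule_weight_decomposition[of V] M.fin_dim_subset
  unfolding category_O_bar_def by blast

lemma indecomposable_object_iff:
  assumes "category_O_bar b h UNIV"
  shows "indecomposable_object b h V \<longleftrightarrow> indecomposable V"
  by (simp add: indecomposable_object_def indecomposable_def category_O_bar_iff_submodule[OF assms])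

lemma hom_weight_space:
  assumes "submodule V" "hom V W f" and "v \<in> V" "v \<in> weight_space h \<mu>"
  shows "f v \<in> weight_space h \<mu>"
  using assms by (simp add: weight_space_def flip: hom_act hom_scale)

lemma hom_weight_component:
  assumes V: "submodule V" and f: "hom V W f" and v: "v \<in> V"
  shows "weight_component \<mu> (f v) = f (weight_component \<mu> v)"
proof (rule M.component_eqI[OF weight_decomposition])
  let ?F = "{\<mu>. weight_component \<mu> v \<noteq> 0}"
  show "finite ?F" by (rule weight_component_facts(1))
  show "f (weight_component \<mu> v) = 0" if "\<mu> \<notin> ?F" for \<mu>
    using that hom_zero[OF V f] by simp
  show "f (weight_component \<mu> v) \<in> weight_space h \<mu>" if "\<mu> \<in> dual h" for \<mu>
    using that by (intro hom_weight_space[OF V f] weight_component_mem[OF V v] weight_component_facts(2))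
  show "f (weight_component \<mu> v) = 0" if "\<mu> \<notin> dual h" for \<mu>
    using that hom_zero[OF V f] weight_component_facts(3) by simp
  have "f v = f (\<Sum>\<mu>\<in>?F. weight_component \<mu> v)" using weight_component_facts(4)[symmetric, of v] by simp
  also have "\<dots> = (\<Sum>\<mu>\<in>?F. f (weight_component \<mu> v))"
    by (rule hom_sum[OF V f]) (rule weight_component_mem[OF V v])
  finally show "f v = (\<Sum>\<mu>\<in>?F. f (weight_component \<mu> v))" .
qed

lemma zero_if_weight_components_zero:
  assumes "\<And>\<mu>. weight_component \<mu> v = 0"
  shows "v = 0"
proof -
  have "v = (\<Sum>\<mu> | weight_component \<mu> v \<noteq> 0. weight_component \<mu> v)" by (rule weight_component_facts(4))
  also have "\<dots> = 0" by (simp add: assms)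
  finally show ?thesis .
qed

text \<open>There is in general no power of \<open>f\<close> that works for all weights, so the two parts are the union of the
  kernels and the intersection of the images of the powers.\<close>

lemma fitting:
  assumes V: "submodule V" and f: "hom V V f"
  defines "A \<equiv> {v \<in> V. \<exists>n. (f ^^ n) v = 0}" and "B \<equiv> {v \<in> V. \<forall>n. v \<in> (f ^^ n) ` V}"
  shows "submodule A" and "submodule B" and "M.complementary V A B"
proof -
  note fn = hom_funpow[OF f]
  have later: "(f ^^ (m + n)) v = 0" if "(f ^^ n) v = 0" for m n v
    using that hom_zero[OF V fn] by (simp add: funpow_add)
  show A: "submodule A"
  proof (rule submoduleI)
    show "0 \<in> A" using V by (auto simp: A_def submodule_zero intro!: exI[of _ 0])
  next
    fix v w assume "v \<in> A" "w \<in> A"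
    then obtain m n where "v \<in> V" "w \<in> V" "(f ^^ m) v = 0" "(f ^^ n) w = 0" by (auto simp: A_def)
    moreover from this have "(f ^^ (m + n)) v = 0" "(f ^^ (m + n)) w = 0"
      using later[of m v n] later[of n w m] by (simp_all add: add.commute)
    ultimately have "(f ^^ (m + n)) (v + w) = 0" "v + w \<in> V"
      using hom_add[OF fn] V by (simp_all add: submodule_add)
    then show "v + w \<in> A" by (auto simp: A_def)
  next
    fix c v assume "v \<in> A"
    then obtain n where n: "v \<in> V" "(f ^^ n) v = 0" by (auto simp: A_def)
    then have "(f ^^ n) (c *m v) = 0" using hom_scale[OF fn] by simp
    then show "c *m v \<in> A" using V n by (auto simp: A_def submodule_scale)
  next
    fix x v assume "v \<in> A"
    then obtain n where n: "v \<in> V" "(f ^^ n) v = 0" by (auto simp: A_def)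
    then have "(f ^^ n) (act x v) = 0" using hom_act[OF fn] by simp
    then show "act x v \<in> A" using V n by (auto simp: A_def submodule_act)
  qed
  have fV: "submodule ((f ^^ n) ` V)" for n by (rule submodule_image[OF V fn])
  show B: "submodule B"
  proof (rule submoduleI)
    show "0 \<in> B" unfolding B_def using submodule_zero[OF fV] submodule_zero[OF V] by blast
  next
    fix v w assume "v \<in> B" "w \<in> B"
    then show "v + w \<in> B" unfolding B_def using submodule_add[OF fV] submodule_add[OF V] by blast
  next
    fix c v assume "v \<in> B"
    then show "c *m v \<in> B" unfolding B_def using submodule_scale[OF fV] submodule_scale[OF V] by blast
  next
    fix x v assume "v \<in> B"
    then show "act x v \<in> B" unfolding B_def using submodule_act[OF fV] submodule_act[OF V] by blast
  qed
  have fin: "M.fin_dim (V \<inter> weight_space h \<mu>)" if "\<mu> \<in> dual h" for \<mu>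
    using M.fin_dim_subset[OF weight_space_fin_dim[OF that]] by blast
  have sub: "M.subspace (V \<inter> weight_space h \<mu>)" for \<mu>
    using V weight_space_subspace by (simp add: submodule_subspace M.subspace_inter)
  \<comment> \<open>The power of \<open>f\<close> that is needed varies with the weight, so the splitting is made one weight at a time.\<close>
  have weightwise: "\<exists>n. (\<forall>v \<in> V \<inter> weight_space h \<mu>. \<exists>a \<in> V \<inter> weight_space h \<mu>. \<exists>b. v = a + b \<and> (f ^^ n) a = 0
        \<and> (\<forall>m. b \<in> (f ^^ m) ` (V \<inter> weight_space h \<mu>)))
      \<and> (\<forall>v \<in> (f ^^ n) ` (V \<inter> weight_space h \<mu>). \<forall>m. (f ^^ m) v = 0 \<longrightarrow> v = 0)"
    if "\<mu> \<in> dual h" for \<mu>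
  proof (rule M.fitting_finite_dimensional[OF sub fin[OF that], of f])
    fix v w assume "v \<in> V \<inter> weight_space h \<mu>" "w \<in> V \<inter> weight_space h \<mu>"
    then show "f (v + w) = f v + f w" using hom_add[OF f] by blast
  next
    fix c v assume "v \<in> V \<inter> weight_space h \<mu>"
    then show "f (c *m v) = c *m f v" using hom_scale[OF f] by blast
  next
    fix v assume "v \<in> V \<inter> weight_space h \<mu>"
    then show "f v \<in> V \<inter> weight_space h \<mu>" using hom_mem[OF f] hom_weight_space[OF V f] by blast
  qed blast
  have "A \<inter> B = {0}"
  proof
    show "{0} \<subseteq> A \<inter> B" using A B by (auto simp: submodule_zero)
    show "A \<inter> B \<subseteq> {0}"
    proof
      fix v assume v: "v \<in> A \<inter> B"
      have "weight_component \<mu> v = 0" for \<mu>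
      proof (cases "\<mu> \<in> dual h")
        case True
        obtain n where n: "\<And>w m. w \<in> (f ^^ n) ` (V \<inter> weight_space h \<mu>) \<Longrightarrow> (f ^^ m) w = 0 \<Longrightarrow> w = 0"
          using weightwise[OF True] by metis
        obtain u where u: "u \<in> V" "v = (f ^^ n) u" using v by (auto simp: B_def)
        have "weight_component \<mu> v = (f ^^ n) (weight_component \<mu> u)"
          unfolding u(2) by (rule hom_weight_component[OF V fn u(1)])
        moreover have "weight_component \<mu> u \<in> V \<inter> weight_space h \<mu>"
          using weight_component_mem[OF V u(1)] weight_component_facts(2)[OF True] by blast
        moreover have "weight_component \<mu> v \<in> A" using weight_component_mem[OF A] v by blast
        then obtain m where "(f ^^ m) (weight_component \<mu> v) = 0" unfolding A_def by blast
        ultimately show ?thesis using n[of "weight_component \<mu> v" m] by (metis imageI)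
      next
        case False
        then show ?thesis by (rule weight_component_facts(3))
      qed
      then have "v = 0" by (rule zero_if_weight_components_zero)
      then show "v \<in> {0}" by simp
    qed
  qed
  moreover have "V = {a + b | a b. a \<in> A \<and> b \<in> B}"
  proof
    show "{a + b | a b. a \<in> A \<and> b \<in> B} \<subseteq> V" using V by (auto simp: A_def B_def submodule_add)
    show "V \<subseteq> {a + b | a b. a \<in> A \<and> b \<in> B}"
    proof
      fix v assume v: "v \<in> V"
      let ?F = "{\<mu>. weight_component \<mu> v \<noteq> 0}"
      have "\<forall>\<mu>\<in>?F. \<exists>a b. weight_component \<mu> v = a + b \<and> a \<in> A \<and> b \<in> B"
      proof
        fix \<mu> assume "\<mu> \<in> ?F"
        then have \<mu>: "\<mu> \<in> dual h" using weight_component_facts(3) by blast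
        then have "weight_component \<mu> v \<in> V \<inter> weight_space h \<mu>"
          using weight_component_mem[OF V v] weight_component_facts(2) by blast
        then obtain a b n where ab: "a \<in> V" "weight_component \<mu> v = a + b" "(f ^^ n) a = 0"
            "\<And>m. b \<in> (f ^^ m) ` (V \<inter> weight_space h \<mu>)"
          using weightwise[OF \<mu>] by blast
        have "b \<in> (f ^^ m) ` V" for m using ab(4)[of m] by blast
        moreover have "b \<in> V" using ab(4)[of 0] by auto
        ultimately show "\<exists>a b. weight_component \<mu> v = a + b \<and> a \<in> A \<and> b \<in> B"
          using ab by (intro exI[of _ a] exI[of _ b]) (auto simp: A_def B_def)
      qed
      then obtain a b where ab: "\<And>\<mu>. \<mu> \<in> ?F \<Longrightarrow> weight_component \<mu> v = a \<mu> + b \<mu> \<and> a \<mu> \<in> A \<and> b \<mu> \<in> B"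
        by metis
      have "v = (\<Sum>\<mu>\<in>?F. weight_component \<mu> v)" by (rule weight_component_facts(4))
      also have "\<dots> = (\<Sum>\<mu>\<in>?F. a \<mu> + b \<mu>)" using ab by (intro sum.cong) auto
      also have "\<dots> = (\<Sum>\<mu>\<in>?F. a \<mu>) + (\<Sum>\<mu>\<in>?F. b \<mu>)" by (rule sum.distrib)
      finally show "v \<in> {a + b | a b. a \<in> A \<and> b \<in> B}"
        using submodule_sum[OF A, of ?F a] submodule_sum[OF B, of ?F b] ab by blast
    qed
  qed
  ultimately show "M.complementary V A B" unfolding M.complementary_def by (rule conjI)
qed

section \<open>Endomorphisms of indecomposable modules\<close>

lemma locally_nilpotent_or_bijective:
  assumes V: "indecomposable V" and f: "hom V V f"
  shows "locally_nilpotent V f \<or> bij_betw f V V"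
proof -
  let ?A = "{v \<in> V. \<exists>n. (f ^^ n) v = 0}" and ?B = "{v \<in> V. \<forall>n. v \<in> (f ^^ n) ` V}"
  note subV = indecomposable_submodule[OF V]
  note fit = fitting[OF subV f]
  have split: "\<exists>a\<in>?A. \<exists>b\<in>?B. v = a + b" if "v \<in> V" for v
  proof -
    have "v \<in> {a + b | a b. a \<in> ?A \<and> b \<in> ?B}"
      using fit(3) that unfolding M.complementary_def by (metis (lifting))
    then show ?thesis by blast
  qed
  have "?A = {0} \<or> ?B = {0}" using V fit unfolding indecomposable_def by blast
  then show ?thesis
  proof
    assume A: "?A = {0}"
    have VB: "V \<subseteq> ?B"
    proof
      fix v assume "v \<in> V"
      then obtain a b where ab: "v = a + b" "a \<in> ?A" "b \<in> ?B" using split by blast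
      then have "a = 0" using A by blast
      then show "v \<in> ?B" using ab(1,3) by simp
    qed
    have ker: "v = 0" if "v \<in> V" "f v = 0" for v
    proof -
      have "(f ^^ 1) v = 0" using that by simp
      then have "v \<in> ?A" using that(1) by blast
      then show ?thesis using A by blast
    qed
    have "inj_on f V"
    proof (rule inj_onI)
      fix v w assume "v \<in> V" "w \<in> V" "f v = f w"
      then have "v - w \<in> V" "f (v - w) = 0"
        by (simp_all add: hom_diff[OF subV f] submodule_diff[OF subV])
      then have "v - w = 0" by (rule ker)
      then show "v = w" by simp
    qed
    moreover have "V \<subseteq> f ` V"
    proof
      fix v assume "v \<in> V"
      then have "v \<in> (f ^^ 1) ` V" using VB by blast
      then show "v \<in> f ` V" by simp
    qed
    moreover have "f ` V \<subseteq> V" using hom_mem[OF f] by blast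
    ultimately have "bij_betw f V V" unfolding bij_betw_def by blast
    then show ?thesis ..
  next
    assume B: "?B = {0}"
    have "v \<in> ?A" if v: "v \<in> V" for v
    proof -
      obtain a b where ab: "v = a + b" "a \<in> ?A" "b \<in> ?B" using split[OF v] by blast
      then have "b = 0" using B by blast
      then show "v \<in> ?A" using ab(1,2) by simp
    qed
    then show ?thesis unfolding locally_nilpotent_def by blast
  qed
qed

text \<open>This criterion is what gives the closure properties of locally nilpotent endomorphisms: an
  endomorphism of an indecomposable module is locally nilpotent as soon as it kills one non-zero vector.\<close>

lemma locally_nilpotent_iff_kernel:
  assumes V: "indecomposable V" and f: "hom V V f"
  shows "locally_nilpotent V f \<longleftrightarrow> (\<exists>v\<in>V. v \<noteq> 0 \<and> f v = 0)"
proof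
  assume nil: "locally_nilpotent V f"
  obtain v where v: "v \<in> V" "v \<noteq> 0" using V by (rule indecomposable_nonzero)
  then obtain n where n: "(f ^^ n) v = 0" "\<And>m. m < n \<Longrightarrow> (f ^^ m) v \<noteq> 0"
    using nil exists_least_iff[of "\<lambda>n. (f ^^ n) v = 0"] by (auto simp: locally_nilpotent_def)
  then obtain m where m: "n = Suc m" using v by (cases n) auto
  then show "\<exists>v\<in>V. v \<noteq> 0 \<and> f v = 0"
    using n n(2)[of m] hom_mem[OF hom_funpow[OF f] v(1)] by (intro bexI[of _ "(f ^^ m) v"]) auto
next
  assume "\<exists>v\<in>V. v \<noteq> 0 \<and> f v = 0"
  then obtain v where v: "v \<in> V" "v \<noteq> 0" "f v = 0" by blast
  have "0 \<in> V" "f 0 = 0" using submodule_zero hom_zero[OF _ f] indecomposable_submodule[OF V] by auto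
  then have "\<not> inj_on f V" using v inj_onD[of f V v 0] by auto
  then show "locally_nilpotent V f"
    using locally_nilpotent_or_bijective[OF V f] by (auto simp: bij_betw_def)
qed

lemma locally_nilpotentI:
  assumes "indecomposable V" "hom V V f" "v \<in> V" "v \<noteq> 0" "f v = 0"
  shows "locally_nilpotent V f"
  unfolding locally_nilpotent_iff_kernel[OF assms(1,2)] using assms(3-5) by (intro bexI conjI)

lemma locally_nilpotentE:
  assumes "indecomposable V" "hom V V f" "locally_nilpotent V f"
  obtains v where "v \<in> V" "v \<noteq> 0" "f v = 0"
proof -
  have "\<exists>v\<in>V. v \<noteq> 0 \<and> f v = 0"
    using assms(3) unfolding locally_nilpotent_iff_kernel[OF assms(1,2)] .
  then show ?thesis by (elim bexE conjE) (rule that)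
qed

lemma locally_nilpotent_comp_left:
  assumes V: "indecomposable V" and f: "hom V V f" "locally_nilpotent V f" and g: "hom V V g"
  shows "locally_nilpotent V (\<lambda>v. g (f v))"
proof -
  obtain v where "v \<in> V" "v \<noteq> 0" "f v = 0" using V f by (rule locally_nilpotentE)
  moreover have "g 0 = 0" by (rule hom_zero[OF indecomposable_submodule[OF V] g])
  ultimately show ?thesis by (intro locally_nilpotentI[OF V hom_comp[OF f(1) g], of v]) simp_all
qed

text \<open>If \<open>f + g\<close> were bijective with inverse \<open>k\<close>, then \<open>k f + k g = 1\<close> with both summands locally
  nilpotent; a non-zero vector killed by \<open>k f\<close> is fixed by \<open>k g\<close>, which is absurd.\<close>

lemma locally_nilpotent_add:
  assumes V: "indecomposable V" and f: "hom V V f" "locally_nilpotent V f"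
    and g: "hom V V g" "locally_nilpotent V g"
  shows "locally_nilpotent V (\<lambda>v. f v + g v)"
proof (rule ccontr)
  note subV = indecomposable_submodule[OF V]
  assume not: "\<not> locally_nilpotent V (\<lambda>v. f v + g v)"
  have hom: "hom V V (\<lambda>v. f v + g v)" by (rule hom_plus[OF subV f(1) g(1)])
  have bij: "bij_betw (\<lambda>v. f v + g v) V V"
    using locally_nilpotent_or_bijective[OF V hom] not by blast
  define k where "k = inv_into V (\<lambda>v. f v + g v)"
  have k: "hom V V k" unfolding k_def by (rule hom_inv_into[OF subV hom bij])
  have kfg: "k (f v) + k (g v) = v" if "v \<in> V" for v
  proof -
    have "k (f v + g v) = v"
      unfolding k_def by (rule bij_betw_inv_into_left[OF bij that])
    then show ?thesis using hom_add[OF k hom_mem[OF f(1) that] hom_mem[OF g(1) that]] by simp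
  qed
  obtain w where w: "w \<in> V" "w \<noteq> 0" "k (f w) = 0"
    using V hom_comp[OF f(1) k] locally_nilpotent_comp_left[OF V f k] by (rule locally_nilpotentE)
  then have "k (g w) = w" using kfg[of w] by simp
  then have "((\<lambda>v. k (g v)) ^^ n) w = w" for n by (induction n) auto
  moreover have "locally_nilpotent V (\<lambda>v. k (g v))" by (rule locally_nilpotent_comp_left[OF V g k])
  ultimately show False using w by (auto simp: locally_nilpotent_def)
qed

lemma locally_nilpotent_zero: "locally_nilpotent V (\<lambda>v. 0)"
  by (auto simp: locally_nilpotent_def intro!: exI[of _ 1])

lemma locally_nilpotent_sum:
  assumes V: "indecomposable V" and f: "\<And>i. i \<in> F \<Longrightarrow> hom V V (f i)" "\<And>i. i \<in> F \<Longrightarrow> locally_nilpotent V (f i)"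
  shows "locally_nilpotent V (\<lambda>v. \<Sum>i\<in>F. f i v)"
  using f
proof (induction F rule: infinite_finite_induct)
  case (insert i F)
  have "hom V V (\<lambda>v. \<Sum>i\<in>F. f i v)"
    using insert.prems by (intro hom_sum_fun indecomposable_submodule[OF V]) auto
  then have "locally_nilpotent V (\<lambda>v. f i v + (\<Sum>i\<in>F. f i v))"
    using insert by (intro locally_nilpotent_add[OF V]) auto
  then show ?case using insert.hyps by simp
qed (simp_all add: locally_nilpotent_zero)

lemma locally_nilpotent_scaled:
  assumes V: "indecomposable V" and f: "hom V V f" "locally_nilpotent V f"
  shows "locally_nilpotent V (\<lambda>v. c *m f v)"
proof -
  obtain v where "v \<in> V" "v \<noteq> 0" "f v = 0" using V f by (rule locally_nilpotentE)
  then show ?thesis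
    by (intro locally_nilpotentI[OF V hom_scaled[OF indecomposable_submodule[OF V] f(1)], of v]) simp_all
qed

lemma indecomposable_weight_vector:
  assumes "indecomposable V"
  obtains \<mu> v where "\<mu> \<in> dual h" "v \<in> V" "v \<in> weight_space h \<mu>" "v \<noteq> 0"
proof -
  obtain v where v: "v \<in> V" "v \<noteq> 0" using assms by (rule indecomposable_nonzero)
  have "\<exists>\<mu>. weight_component \<mu> v \<noteq> 0"
  proof (rule ccontr)
    assume "\<nexists>\<mu>. weight_component \<mu> v \<noteq> 0"
    then have "weight_component \<mu> v = 0" for \<mu> by simp
    then have "v = 0" by (rule zero_if_weight_components_zero)
    with v(2) show False ..
  qed
  then obtain \<mu> where \<mu>: "weight_component \<mu> v \<noteq> 0" by (elim exE)
  have dual: "\<mu> \<in> dual h" using \<mu> weight_component_facts(3)[of \<mu> v] by (rule contrapos_np)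
  show ?thesis
    by (rule that[OF dual weight_component_mem[OF indecomposable_submodule[OF assms] v(1)]
          weight_component_facts(2)[OF dual] \<mu>])
qed

text \<open>Subtract an eigenvalue of \<open>f\<close> on some non-zero weight space of \<open>V\<close>: the difference kills an
  eigenvector.\<close>

lemma endomorphism_scalar_plus_nilpotent:
  assumes V: "indecomposable V" and f: "hom V V f"
  shows "\<exists>c. locally_nilpotent V (\<lambda>v. f v - c *m v)"
proof -
  note subV = indecomposable_submodule[OF V]
  obtain \<mu> v where \<mu>: "\<mu> \<in> dual h" and v: "v \<in> V" "v \<in> weight_space h \<mu>" "v \<noteq> 0"
    using V by (rule indecomposable_weight_vector)
  have "\<exists>c. \<exists>w\<in>V \<inter> weight_space h \<mu>. w \<noteq> 0 \<and> f w = c *m w"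
  proof (rule eigenvector_exists)
    show "vector_space scaleM" by (rule M.vector_space_axioms)
    show "M.subspace (V \<inter> weight_space h \<mu>)"
      using subV weight_space_subspace by (simp add: submodule_subspace M.subspace_inter)
    show "M.fin_dim (V \<inter> weight_space h \<mu>)"
      by (rule M.fin_dim_subset[OF weight_space_fin_dim[OF \<mu>]]) blast
    show "V \<inter> weight_space h \<mu> \<noteq> {0}" using v by blast
  next
    fix v w assume "v \<in> V \<inter> weight_space h \<mu>" "w \<in> V \<inter> weight_space h \<mu>"
    then show "f (v + w) = f v + f w" using hom_add[OF f] by blast
  next
    fix c v assume "v \<in> V \<inter> weight_space h \<mu>"
    then show "f (c *m v) = c *m f v" using hom_scale[OF f] by blast
  next
    fix v assume "v \<in> V \<inter> weight_space h \<mu>"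
    then show "f v \<in> V \<inter> weight_space h \<mu>" using hom_mem[OF f] hom_weight_space[OF subV f] by blast
  qed
  then obtain c w where w: "w \<in> V" "w \<noteq> 0" "f w = c *m w" by blast
  have "hom V V (\<lambda>v. f v - c *m v)" by (rule hom_minus[OF subV f hom_scaled[OF subV hom_id]])
  then have "locally_nilpotent V (\<lambda>v. f v - c *m v)"
    using w by (intro locally_nilpotentI[OF V, of _ w]) simp_all
  then show ?thesis by blast
qed

text \<open>If \<open>b a\<close> is bijective then \<open>a\<close> is injective and \<open>W = a(V) \<oplus> ker b\<close>; indecomposability of \<open>W\<close> leaves
  only \<open>W = a(V)\<close>.\<close>

lemma isomorphic_if_factor_not_nilpotent:
  assumes V: "indecomposable V" and W: "indecomposable W" and a: "hom V W a" and b: "hom W V b"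
    and not: "\<not> locally_nilpotent V (\<lambda>v. b (a v))"
  shows "isomorphic V W"
proof -
  note subV = indecomposable_submodule[OF V] and subW = indecomposable_submodule[OF W]
  let ?K = "{w \<in> W. b w = 0}"
  have bij: "bij_betw (\<lambda>v. b (a v)) V V"
    using locally_nilpotent_or_bijective[OF V hom_comp[OF a b]] not by blast
  have a0: "a 0 = 0" and b0: "b 0 = 0" using hom_zero[OF subV a] hom_zero[OF subW b] by auto
  have inj: "inj_on (\<lambda>v. b (a v)) V" using bij by (simp add: bij_betw_def)
  have subs: "submodule (a ` V)" "submodule ?K"
    by (rule submodule_image[OF subV a], rule submodule_kernel[OF subW b])
  have "a ` V \<inter> ?K = {0}"
  proof
    show "{0} \<subseteq> a ` V \<inter> ?K" using submodule_zero[OF subs(1)] submodule_zero[OF subs(2)] by blast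
    show "a ` V \<inter> ?K \<subseteq> {0}"
    proof
      fix w assume "w \<in> a ` V \<inter> ?K"
      then obtain v where v: "v \<in> V" "w = a v" "b (a v) = b (a 0)" using a0 b0 by auto
      then have "v = 0" using inj_onD[OF inj v(3)] submodule_zero[OF subV] by blast
      then show "w \<in> {0}" using v a0 by simp
    qed
  qed
  moreover have "W = {x + y | x y. x \<in> a ` V \<and> y \<in> ?K}"
  proof
    show "{x + y | x y. x \<in> a ` V \<and> y \<in> ?K} \<subseteq> W"
      using hom_mem[OF a] submodule_add[OF subW] by blast
    show "W \<subseteq> {x + y | x y. x \<in> a ` V \<and> y \<in> ?K}"
    proof
      fix w assume w: "w \<in> W"
      then have "b w \<in> (\<lambda>v. b (a v)) ` V" using bij hom_mem[OF b] by (simp add: bij_betw_def)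
      then obtain v where v: "v \<in> V" "b w = b (a v)" by blast
      have "w - a v \<in> ?K"
        using w v hom_mem[OF a v(1)] by (simp add: hom_diff[OF subW b] submodule_diff[OF subW])
      moreover have "w = a v + (w - a v)" by simp
      ultimately show "w \<in> {x + y | x y. x \<in> a ` V \<and> y \<in> ?K}" using v(1) by blast
    qed
  qed
  ultimately have comp: "M.complementary W (a ` V) ?K" unfolding M.complementary_def by (rule conjI)
  have inja: "inj_on a V" using inj by (auto simp: inj_on_def)
  obtain v where "v \<in> V" "v \<noteq> 0" using V by (rule indecomposable_nonzero)
  then have "a v \<noteq> 0" using inj_onD[OF inja, of v 0] a0 submodule_zero[OF subV] by auto
  then have "a ` V \<noteq> {0}" using \<open>v \<in> V\<close> by blast
  then have K: "?K = {0}" using W subs comp unfolding indecomposable_def by blast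
  have "W \<subseteq> a ` V"
  proof
    fix w assume "w \<in> W"
    then obtain x y where xy: "w = x + y" "x \<in> a ` V" "y \<in> ?K"
      using comp unfolding M.complementary_def by blast
    then have "y = 0" using K by blast
    then show "w \<in> a ` V" using xy by simp
  qed
  then have "bij_betw a V W" using inja hom_mem[OF a] by (auto simp: bij_betw_def)
  then show ?thesis using a isomorphic_iff_hom by blast
qed

section \<open>Uniqueness of the decomposition\<close>

text \<open>A summand isomorphic to \<open>V\<close> meets every weight space that \<open>V\<close> meets, and a finite-dimensional
  weight space meets only finitely many summands.\<close>

lemma finite_isomorphic_summands:
  assumes ds: "M.direct_sum UNIV J N" and V: "indecomposable V"
  shows "finite {j \<in> J. isomorphic V (N j)}"
proof -
  obtain \<mu> v where \<mu>: "\<mu> \<in> dual h" and v: "v \<in> V" "v \<in> weight_space h \<mu>" "v \<noteq> 0"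
    using V by (rule indecomposable_weight_vector)
  note subV = indecomposable_submodule[OF V]
  have "{j \<in> J. isomorphic V (N j)} \<subseteq> {j \<in> J. \<exists>w\<in>N j \<inter> weight_space h \<mu>. w \<noteq> 0}"
  proof clarify
    fix j assume "j \<in> J" "isomorphic V (N j)"
    then obtain f where f: "hom V (N j) f" "bij_betw f V (N j)" by (auto simp: isomorphic_iff_hom)
    then have "inj_on f V" by (simp add: bij_betw_def)
    then have "f v \<noteq> 0"
      using v hom_zero[OF subV f(1)] submodule_zero[OF subV] inj_onD[of f V v 0] by auto
    then show "\<exists>w\<in>N j \<inter> weight_space h \<mu>. w \<noteq> 0"
      using hom_mem[OF f(1) v(1)] hom_weight_space[OF subV f(1) v(1,2)] by blast
  qed
  then show ?thesis
    using M.finite_summands_meeting_fin_dim[OF ds weight_space_fin_dim[OF \<mu>]] finite_subset by blast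
qed

text \<open>Here \<open>\<phi> j\<close> and \<open>g j\<close> are the embedding of \<open>V\<close> as the summand \<open>N j\<close> and the projection back, so that
  \<open>g i \<circ> \<phi> j\<close> is \<open>1\<close> or \<open>0\<close>, and \<open>c k j\<close> is the scalar to which the endomorphism \<open>g' k \<circ> \<phi> j\<close>
  of \<open>V\<close> reduces modulo locally nilpotent ones. With fewer \<open>k\<close> than \<open>j\<close> there is a non-trivial
  combination \<open>f\<close> of the \<open>\<phi> j\<close> for which all \<open>g' k \<circ> f\<close> are locally nilpotent, while \<open>g i \<circ> f\<close>
  is a non-zero scalar for some \<open>i\<close>. Expanding \<open>g i \<circ> f\<close> over all summands \<open>L k\<close> gives a contradiction,
  since a summand not isomorphic to \<open>V\<close> contributes a locally nilpotent endomorphism anyway.\<close>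

lemma multiplicity_le:
  assumes J: "M.direct_sum UNIV J N" "\<And>j. j \<in> J \<Longrightarrow> indecomposable (N j)"
    and K: "M.direct_sum UNIV K L" "\<And>k. k \<in> K \<Longrightarrow> indecomposable (L k)"
    and V: "indecomposable V"
  shows "card {j \<in> J. isomorphic V (N j)} \<le> card {k \<in> K. isomorphic V (L k)}"
proof (rule ccontr)
  define I where "I = {j \<in> J. isomorphic V (N j)}"
  define I' where "I' = {k \<in> K. isomorphic V (L k)}"
  assume "\<not> ?thesis"
  then have card: "card I' < card I" by (simp add: I_def I'_def)
  have fin: "finite I" "finite I'"
    using finite_isomorphic_summands[OF _ V] J(1) K(1) by (auto simp: I_def I'_def)
  have subJ: "\<And>j. j \<in> J \<Longrightarrow> submodule (N j)" and subK: "\<And>k. k \<in> K \<Longrightarrow> submodule (L k)"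
    using J(2) K(2) by (auto intro: indecomposable_submodule)
  note subV = indecomposable_submodule[OF V]
  have "\<forall>j\<in>I. \<exists>\<phi>. hom V (N j) \<phi> \<and> bij_betw \<phi> V (N j)" by (auto simp: I_def isomorphic_iff_hom)
  then obtain \<phi> where \<phi>: "\<And>j. j \<in> I \<Longrightarrow> hom V (N j) (\<phi> j)" "\<And>j. j \<in> I \<Longrightarrow> bij_betw (\<phi> j) V (N j)"
    by metis
  have "\<forall>k\<in>I'. \<exists>\<phi>. hom V (L k) \<phi> \<and> bij_betw \<phi> V (L k)" by (auto simp: I'_def isomorphic_iff_hom)
  then obtain \<phi>' where \<phi>': "\<And>k. k \<in> I' \<Longrightarrow> hom V (L k) (\<phi>' k)" "\<And>k. k \<in> I' \<Longrightarrow> bij_betw (\<phi>' k) V (L k)"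
    by metis
  define p where "p = M.component J N"
  define p' where "p' = M.component K L"
  have p: "hom UNIV (N j) (p j)" if "j \<in> J" for j
    unfolding p_def using hom_component[OF J(1) subJ that] by blast
  have p': "hom UNIV (L k) (p' k)" if "k \<in> K" for k
    unfolding p'_def using hom_component[OF K(1) subK that] by blast
  define g where "g j v = inv_into V (\<phi> j) (p j v)" for j v
  define g' where "g' k v = inv_into V (\<phi>' k) (p' k v)" for k v
  have invh: "hom (N j) V (inv_into V (\<phi> j))" if "j \<in> I" for j
    by (rule hom_inv_into[OF subV \<phi>(1)[OF that] \<phi>(2)[OF that]])
  have g: "hom UNIV V (g j)" if "j \<in> I" for j
    unfolding g_def using hom_comp[OF p invh] that I_def by blast
  have g': "hom UNIV V (g' k)" if "k \<in> I'" for k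
  proof -
    have "hom (L k) V (inv_into V (\<phi>' k))" by (rule hom_inv_into[OF subV \<phi>'(1)[OF that] \<phi>'(2)[OF that]])
    then show ?thesis unfolding g'_def using hom_comp[OF p'] that I'_def by blast
  qed
  have \<phi>U: "hom V UNIV (\<phi> j)" if "j \<in> I" for j
    using hom_subset[OF \<phi>(1)[OF that]] by blast
  have g\<phi>: "g i (\<phi> j v) = (if i = j then v else 0)" if ij: "i \<in> I" "j \<in> I" and v: "v \<in> V" for i j v
  proof -
    have "j \<in> J" "\<phi> j v \<in> N j" using ij hom_mem[OF \<phi>(1) v] by (auto simp: I_def)
    then have pi: "p i (\<phi> j v) = (if i = j then \<phi> j v else 0)"
      unfolding p_def by (rule M.component_self[OF J(1)])
    show ?thesis
    proof (cases "i = j")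
      case True
      then show ?thesis
        using pi \<phi>(2)[OF ij(2)] v by (simp add: g_def bij_betw_def inv_into_f_f)
    next
      case False
      then have "g i (\<phi> j v) = inv_into V (\<phi> i) 0" using pi by (simp add: g_def)
      also have "\<dots> = 0" using ij subJ by (intro hom_zero[OF _ invh]) (auto simp: I_def)
      finally show ?thesis using False by simp
    qed
  qed
  have "\<exists>c. locally_nilpotent V (\<lambda>v. g' k (\<phi> j v) - c *m v)" if "k \<in> I'" "j \<in> I" for k j
    by (rule endomorphism_scalar_plus_nilpotent[OF V hom_comp[OF \<phi>U[OF that(2)] g'[OF that(1)]]])
  then obtain c where c: "\<And>k j. k \<in> I' \<Longrightarrow> j \<in> I \<Longrightarrow> locally_nilpotent V (\<lambda>v. g' k (\<phi> j v) - c k j *m v)"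
    by metis
  obtain x i where x: "\<forall>k\<in>I'. (\<Sum>j\<in>I. c k j * x j) = 0" and i: "i \<in> I" "x i \<noteq> 0"
    using homogeneous_system_nontrivial_solution[OF fin(2,1) card, of c] by blast
  define f where "f v = (\<Sum>j\<in>I. x j *m \<phi> j v)" for v
  have f: "hom V UNIV f"
    unfolding f_def by (intro hom_sum_fun submodule_UNIV hom_scaled \<phi>U)
  have g'f: "locally_nilpotent V (\<lambda>v. g' k (f v))" if k: "k \<in> I'" for k
  proof -
    have sum0: "(\<Sum>j\<in>I. (x j * c k j) *m v) = 0" for v
      using x k by (simp add: mult.commute flip: M.scale_sum_left)
    have eq: "g' k (f v) = (\<Sum>j\<in>I. x j *m (g' k (\<phi> j v) - c k j *m v))" for v
    proof -
      have "g' k (f v) = (\<Sum>j\<in>I. x j *m g' k (\<phi> j v))"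
        unfolding f_def by (subst hom_sum[OF submodule_UNIV g'[OF k]]) (simp_all add: hom_scale[OF g'[OF k]])
      then show ?thesis
        using sum0[of v] by (simp add: M.scale_right_diff_distrib sum_subtractf)
    qed
    have nil: "hom V V (\<lambda>v. g' k (\<phi> j v) - c k j *m v)" if "j \<in> I" for j
      by (rule hom_minus[OF subV hom_comp[OF \<phi>U[OF that] g'[OF k]] hom_scaled[OF subV hom_id]])
    show ?thesis
      unfolding eq
      by (intro locally_nilpotent_sum[OF V] hom_scaled[OF subV] nil locally_nilpotent_scaled[OF V] c k)
  qed
  have gf: "g i (f v) = x i *m v" if "v \<in> V" for v
  proof -
    have "g i (f v) = (\<Sum>j\<in>I. x j *m g i (\<phi> j v))"
      unfolding f_def by (subst hom_sum[OF submodule_UNIV g[OF i(1)]]) (simp_all add: hom_scale[OF g[OF i(1)]])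
    also have "\<dots> = (\<Sum>j\<in>I. if j = i then x i *m v else 0)"
      using that i by (intro sum.cong) (auto simp: g\<phi>)
    finally show ?thesis using fin i by simp
  qed
  have factor: "hom V V (\<lambda>v. g i (p' k (f v)))" if "k \<in> K" for k
    using hom_comp[OF hom_comp[OF f p'[OF that]] hom_subset[OF g[OF i(1)]]] by simp
  have nil: "locally_nilpotent V (\<lambda>v. g i (p' k (f v)))" if k: "k \<in> K" for k
  proof (cases "k \<in> I'")
    case True
    have "p' k (f v) = \<phi>' k (g' k (f v))" for v
      unfolding g'_def using hom_mem[OF p'[OF k]] \<phi>'(2)[OF True]
      by (simp add: bij_betw_def f_inv_into_f)
    moreover have "hom V V (\<lambda>v. g i (\<phi>' k v))"
      using hom_comp[OF \<phi>'(1)[OF True] hom_subset[OF g[OF i(1)]]] by simp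
    ultimately show ?thesis
      using locally_nilpotent_comp_left[OF V hom_comp[OF f g'[OF True]] g'f[OF True]] by simp
  next
    case False
    then have "\<not> isomorphic V (L k)" using k by (simp add: I'_def)
    moreover have "hom (L k) V (g i)" using hom_subset[OF g[OF i(1)]] by simp
    ultimately show ?thesis
      using isomorphic_if_factor_not_nilpotent[OF V K(2)[OF k] hom_comp[OF f p'[OF k]]] by blast
  qed
  obtain v where v: "v \<in> V" "v \<noteq> 0" using V by (rule indecomposable_nonzero)
  \<comment> \<open>Only finitely many summands \<open>L k\<close> are visible at \<open>f v\<close>; truncating the identity
    \<open>\<Sum>k. p' k = 1\<close> to them leaves an error that kills \<open>v\<close>.\<close>
  define F where "F = {k. p' k (f v) \<noteq> 0}"
  have F: "F \<subseteq> K"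
    unfolding F_def p'_def using M.component_outside[OF K(1)] by blast
  let ?s = "\<lambda>u. \<Sum>k\<in>F. g i (p' k (f u))"
  let ?r = "\<lambda>u. x i *m u - ?s u"
  have homs: "hom V V ?s" using F by (intro hom_sum_fun subV factor) blast
  then have homr: "hom V V ?r" by (intro hom_minus subV hom_scaled hom_id)
  have "?s v = g i (\<Sum>k\<in>F. p' k (f v))" by (rule hom_sum[OF submodule_UNIV g[OF i(1)], symmetric]) simp
  also have "(\<Sum>k\<in>F. p' k (f v)) = f v"
    unfolding F_def p'_def by (rule M.sum_component[OF K(1), symmetric])
  finally have "?r v = 0" using gf v by simp
  with v have "locally_nilpotent V ?r" by (intro locally_nilpotentI[OF V homr, of v])
  moreover have "locally_nilpotent V ?s" using F by (intro locally_nilpotent_sum[OF V] factor nil) blast+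
  ultimately have "locally_nilpotent V (\<lambda>u. ?r u + ?s u)" by (intro locally_nilpotent_add[OF V] homr homs)
  then have "locally_nilpotent V (\<lambda>u. x i *m u)" by simp
  with V hom_scaled[OF subV hom_id] obtain w where "w \<in> V" "w \<noteq> 0" "x i *m w = 0"
    by (rule locally_nilpotentE)
  then show False using i by simp
qed

lemma decomposition_unique:
  assumes J: "M.direct_sum UNIV J N" "\<And>j. j \<in> J \<Longrightarrow> indecomposable (N j)"
    and K: "M.direct_sum UNIV K L" "\<And>k. k \<in> K \<Longrightarrow> indecomposable (L k)"
  shows "\<exists>\<psi>. bij_betw \<psi> J K \<and> (\<forall>j\<in>J. isomorphic (N j) (L (\<psi> j)))"
proof -
  let ?c = "\<lambda>V. {W. isomorphic V W}"
  have class_eq: "?c W = ?c V \<longleftrightarrow> isomorphic V W" if "indecomposable V" "indecomposable W" for V W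
    using isomorphic_refl isomorphic_trans isomorphic_sym that indecomposable_submodule by blast
  have fibres: "finite {j \<in> J. ?c (N j) = x} \<and> finite {k \<in> K. ?c (L k) = x} \<and>
      card {j \<in> J. ?c (N j) = x} = card {k \<in> K. ?c (L k) = x}" for x
  proof (cases "\<exists>V. indecomposable V \<and> x = ?c V")
    case True
    then obtain V where V: "indecomposable V" and x: "x = ?c V" by blast
    have "{j \<in> J. ?c (N j) = x} = {j \<in> J. isomorphic V (N j)}"
      unfolding x using class_eq[OF V J(2)] by blast
    moreover have "{k \<in> K. ?c (L k) = x} = {k \<in> K. isomorphic V (L k)}"
      unfolding x using class_eq[OF V K(2)] by blast
    ultimately show ?thesis
      using finite_isomorphic_summands[OF J(1) V] finite_isomorphic_summands[OF K(1) V]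
        multiplicity_le[OF J K V] multiplicity_le[OF K J V] by simp
  next
    case False
    then have empty: "{j \<in> J. ?c (N j) = x} = {}" "{k \<in> K. ?c (L k) = x} = {}"
      using J(2) K(2) by blast+
    show ?thesis unfolding empty by simp
  qed
  have "\<exists>\<psi>. bij_betw \<psi> J K \<and> (\<forall>j\<in>J. ?c (L (\<psi> j)) = ?c (N j))"
    by (rule bij_betw_of_equinumerous_fibres) (use fibres in blast)+
  then obtain \<psi> where \<psi>: "bij_betw \<psi> J K" "\<And>j. j \<in> J \<Longrightarrow> ?c (L (\<psi> j)) = ?c (N j)" by blast
  have "isomorphic (N j) (L (\<psi> j))" if "j \<in> J" for j
    using \<psi>(2)[OF that] isomorphic_refl[of "L (\<psi> j)"] by blast
  with \<psi>(1) show ?thesis by blast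
qed

section \<open>Existence of the decomposition\<close>

lemma joint_eigenspaceD: "v \<in> joint_eigenspace E S \<Longrightarrow> e \<in> E \<Longrightarrow> e v = (if e \<in> S then v else 0)"
  unfolding joint_eigenspace_def by blast

lemma submodule_joint_eigenspace:
  assumes "\<And>e. e \<in> E \<Longrightarrow> hom UNIV UNIV e"
  shows "submodule (joint_eigenspace E S)"
proof (rule submoduleI)
  have "e 0 = 0" if "e \<in> E" for e by (rule hom_zero[OF submodule_UNIV assms[OF that]])
  then show "0 \<in> joint_eigenspace E S" by (simp add: joint_eigenspace_def)
next
  fix v w assume vw: "v \<in> joint_eigenspace E S" "w \<in> joint_eigenspace E S"
  have "e (v + w) = (if e \<in> S then v + w else 0)" if "e \<in> E" for e
    using vw[THEN joint_eigenspaceD, OF that] hom_add[OF assms[OF that] UNIV_I UNIV_I, of v w] by simp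
  then show "v + w \<in> joint_eigenspace E S" by (simp add: joint_eigenspace_def)
next
  fix c v assume v: "v \<in> joint_eigenspace E S"
  have "e (c *m v) = (if e \<in> S then c *m v else 0)" if "e \<in> E" for e
    using v[THEN joint_eigenspaceD, OF that] hom_scale[OF assms[OF that] UNIV_I, of c v] by simp
  then show "c *m v \<in> joint_eigenspace E S" by (simp add: joint_eigenspace_def)
next
  fix x v assume v: "v \<in> joint_eigenspace E S"
  have "e (act x v) = (if e \<in> S then act x v else 0)" if "e \<in> E" for e
    using v[THEN joint_eigenspaceD, OF that] hom_act[OF assms[OF that] UNIV_I, of x v] by simp
  then show "act x v \<in> joint_eigenspace E S" by (simp add: joint_eigenspace_def)
qed

text \<open>The index set consists of the non-zero joint eigenspaces of a maximal set of commuting idempotent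
  endomorphisms.\<close>

lemma decomposition_exists:
  "\<exists>J. M.direct_sum UNIV J (\<lambda>X. X) \<and> (\<forall>X\<in>J. indecomposable X)"
proof -
  define \<E> where "\<E> = {E. (\<forall>e\<in>E. hom UNIV UNIV e \<and> (\<forall>v. e (e v) = e v)) \<and>
    (\<forall>e\<in>E. \<forall>e'\<in>E. \<forall>v. e (e' v) = e' (e v))}"
  have "\<exists>E\<in>\<E>. \<forall>E'\<in>\<E>. E \<subseteq> E' \<longrightarrow> E' = E"
  proof (rule subset_Zorn')
    fix C assume C: "subset.chain \<E> C"
    have "e (e' v) = e' (e v)" if e: "e \<in> \<Union>C" "e' \<in> \<Union>C" for e e' v
    proof -
      obtain X Y where XY: "e \<in> X" "e' \<in> Y" "X \<in> C" "Y \<in> C" using e by blast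
      then have "X \<subseteq> Y \<or> Y \<subseteq> X" using C by (auto simp: subset_chain_def)
      then obtain Z where "Z \<in> C" "e \<in> Z" "e' \<in> Z" using XY by blast
      moreover have "C \<subseteq> \<E>" using C by (auto simp: subset_chain_def)
      ultimately show ?thesis unfolding \<E>_def by blast
    qed
    moreover have "hom UNIV UNIV e \<and> (\<forall>v. e (e v) = e v)" if "e \<in> \<Union>C" for e
      using C that unfolding subset_chain_def \<E>_def by blast
    ultimately show "\<Union>C \<in> \<E>" unfolding \<E>_def by blast
  qed
  then obtain E where E: "E \<in> \<E>" and max: "\<And>E'. E' \<in> \<E> \<Longrightarrow> E \<subseteq> E' \<Longrightarrow> E' = E" by blast
  have hom: "hom UNIV UNIV e" and idem: "e (e v) = e v" if "e \<in> E" for e v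
    using E that unfolding \<E>_def by blast+
  have comm: "e (e' v) = e' (e v)" if "e \<in> E" "e' \<in> E" for e e' v
    using E that unfolding \<E>_def by blast
  define J where "J = joint_eigenspace E ` Pow E - {{0}}"
  have sub: "submodule X" if "X \<in> J" for X
    using that submodule_joint_eigenspace[of E, OF hom] by (auto simp: J_def)
  have "\<forall>X\<in>J. \<exists>S\<subseteq>E. X = joint_eigenspace E S" by (auto simp: J_def)
  then obtain S where S: "\<And>X. X \<in> J \<Longrightarrow> S X \<subseteq> E" "\<And>X. X \<in> J \<Longrightarrow> X = joint_eigenspace E (S X)"
    by metis
  have eig: "e v = (if e \<in> S X then v else 0)" if "X \<in> J" "v \<in> X" "e \<in> E" for X v e
  proof -
    have "v \<in> joint_eigenspace E (S X)" using S(2)[OF that(1)] that(2) by (rule subst)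
    then show ?thesis using that(3) by (rule joint_eigenspaceD)
  qed
  have ds: "M.direct_sum UNIV J (\<lambda>X. X)"
  proof (rule M.direct_sumI)
    show "UNIV \<subseteq> M.span (\<Union>X\<in>J. X)"
    proof
      fix v :: 'm
      have span: "weight_space h \<mu> \<subseteq> M.span (\<Union>S\<in>Pow E. joint_eigenspace E S)" if "\<mu> \<in> dual h" for \<mu>
      proof (rule M.commuting_idempotents_joint_eigenvectors)
        fix e v w assume e: "e \<in> E"
        show "e (v + w) = e v + e w" using hom_add[OF hom[OF e]] by simp
      next
        fix e c v assume e: "e \<in> E"
        show "e (c *m v) = c *m e v" using hom_scale[OF hom[OF e]] by simp
      next
        fix e v assume "e \<in> E" "v \<in> weight_space h \<mu>"
        then show "e v \<in> weight_space h \<mu>"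
          by (rule hom_weight_space[OF submodule_UNIV hom[of e] UNIV_I])
      next
        fix e v assume "e \<in> E"
        then show "e (e v) = e v" by (rule idem[of e v])
      next
        fix e e' v assume "e \<in> E" "e' \<in> E"
        then show "e (e' v) = e' (e v)" by (rule comm[of e e' v])
      next
        show "M.subspace (weight_space h \<mu>)" by (rule weight_space_subspace)
        show "M.fin_dim (weight_space h \<mu>)" by (rule weight_space_fin_dim[OF that])
      qed
      have "M.span (\<Union>S\<in>Pow E. joint_eigenspace E S) \<subseteq> M.span (\<Union>X\<in>J. X)"
      proof (intro M.span_minimal M.subspace_span subsetI)
        fix w assume "w \<in> (\<Union>S\<in>Pow E. joint_eigenspace E S)"
        then have "w \<in> (\<Union>X\<in>J. X) \<or> w = 0" unfolding J_def by blast
        then show "w \<in> M.span (\<Union>X\<in>J. X)" by (elim disjE) (auto intro: M.span_base M.span_zero)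
      qed
      moreover have "weight_component \<mu> v \<in> M.span (\<Union>S\<in>Pow E. joint_eigenspace E S)" for \<mu>
      proof (cases "\<mu> \<in> dual h")
        case True
        then show ?thesis using span[OF True] weight_component_facts(2)[OF True, of v] by blast
      next
        case False
        show ?thesis unfolding weight_component_facts(3)[OF False] by (rule M.span_zero)
      qed
      ultimately have "(\<Sum>\<mu> | weight_component \<mu> v \<noteq> 0. weight_component \<mu> v) \<in> M.span (\<Union>X\<in>J. X)"
        by (intro M.span_sum) blast
      with weight_component_facts(4)[symmetric, of v] show "v \<in> M.span (\<Union>X\<in>J. X)" by (rule subst)
    qed
  next
    fix F f X
    assume F: "finite F" "F \<subseteq> J" "\<And>X. X \<in> F \<Longrightarrow> f X \<in> X" "(\<Sum>X\<in>F. f X) = 0" "X \<in> F"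
    have "f X \<in> {0}"
    proof (rule M.joint_eigenvectors_in_subspace[where T = "\<lambda>e. e" and E = E and F = F
          and \<chi> = "\<lambda>X e. if e \<in> S X then 1 else 0"])
      show "M.subspace {0}" by (rule M.subspace_single_0)
    next
      fix X Y assume XY: "X \<in> F" "Y \<in> F" "X \<noteq> Y"
      then have "S X \<noteq> S Y" using S F(2) by (metis subsetD)
      then show "\<exists>e\<in>E. (if e \<in> S X then 1 else 0) \<noteq> (if e \<in> S Y then 1 else (0::'k))"
        using S(1) XY F(2) by (auto; blast)
    next
      fix X e assume "X \<in> F" "e \<in> E"
      then show "e (f X) = (if e \<in> S X then 1 else 0) *m f X"
        using eig[of X "f X" e] F by auto
    next
      fix e v w assume e: "e \<in> E"
      show "e (v + w) = e v + e w" using hom_add[OF hom[OF e]] by simp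
    next
      fix e c v assume e: "e \<in> E"
      show "e (c *m v) = c *m e v" using hom_scale[OF hom[OF e]] by simp
    next
      fix e and v :: 'm assume "e \<in> E" "v \<in> {0}"
      then show "e v \<in> {0}" using hom_zero[OF submodule_UNIV hom] by simp
    qed (use F in auto)
    then show "f X = 0" by simp
  qed (use sub in \<open>auto simp: submodule_subspace\<close>)
  have "indecomposable X" if X: "X \<in> J" for X
    unfolding indecomposable_def
  proof (intro conjI notI)
    show "submodule X" by (rule sub[OF X])
    show "X = {0} \<Longrightarrow> False" using X by (simp add: J_def)
    assume "\<exists>A B. submodule A \<and> submodule B \<and> A \<noteq> {0} \<and> B \<noteq> {0} \<and> M.complementary X A B"
    then obtain A B where AB: "submodule A" "submodule B" "A \<noteq> {0}" "B \<noteq> {0}" "M.complementary X A B"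
      by blast
    obtain q where q: "hom X A q" "\<And>a. a \<in> A \<Longrightarrow> q a = a" "\<And>b. b \<in> B \<Longrightarrow> q b = 0"
      using complementary_projection[OF AB(1,2,5)] by blast
    have Xeq: "X = {a + b | a b. a \<in> A \<and> b \<in> B}" using AB(5) by (simp add: M.complementary_def)
    have AX: "A \<subseteq> X" using Xeq submodule_zero[OF AB(2)] by force
    have BX: "B \<subseteq> X" using Xeq submodule_zero[OF AB(1)] by force
    let ?p = "M.component J (\<lambda>X. X) X"
    have p: "hom UNIV X ?p" using hom_component[OF ds _ X] sub by blast
    have pX: "?p v = v" if "v \<in> X" for v
      using M.component_self[OF ds X] that by auto
    \<comment> \<open>The idempotent with image \<open>A\<close> that kills \<open>B\<close> and all other joint eigenspaces; it commutes with
      \<open>E\<close> because each element of \<open>E\<close> is a scalar on \<open>X\<close>.\<close>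
    define e where "e v = q (?p v)" for v
    have eA: "e v \<in> A" for v unfolding e_def using hom_mem[OF q(1)] hom_mem[OF p] by blast
    have homA: "hom UNIV A e" unfolding e_def by (rule hom_comp[OF p q(1)])
    have ea: "e a = a" if "a \<in> A" for a using that AX pX q(2) by (auto simp: e_def)
    have eb: "e b = 0" if "b \<in> B" for b using that BX pX q(3) by (auto simp: e_def)
    have commute: "e (e' v) = e' (e v)" if e': "e' \<in> E" for e' v
    proof -
      have "?p (e' v) = e' (?p v)"
      proof (rule M.component_commute[OF ds])
        show "e' (v + w) = e' v + e' w" for v w using hom_add[OF hom[OF e']] by simp
        show "e' v \<in> Y" if "Y \<in> J" "v \<in> Y" for Y v
          using eig[OF that e'] that sub[OF that(1)] by (auto simp: submodule_zero)
      qed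
      moreover have "e' (?p v) = (if e' \<in> S X then ?p v else 0)"
        using hom_mem[OF p] by (intro eig[OF X _ e']) simp
      moreover have "e' (e v) = (if e' \<in> S X then e v else 0)"
        using eA AX by (intro eig[OF X _ e']) blast
      ultimately show ?thesis using hom_zero[OF sub[OF X] q(1)] by (simp add: e_def)
    qed
    have "insert e E \<in> \<E>"
      using E hom_subset[OF homA, of UNIV UNIV] ea[OF eA] commute unfolding \<E>_def by auto
    then have "e \<in> E" using max by blast
    have "B = {0} \<or> A = {0}"
    proof (cases "e \<in> S X")
      case True
      have "b = 0" if "b \<in> B" for b
        using eig[OF X subsetD[OF BX that] \<open>e \<in> E\<close>] eb[OF that] True by simp
      then show ?thesis using submodule_zero[OF AB(2)] by blast
    next
      case False
      have "a = 0" if "a \<in> A" for a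
        using eig[OF X subsetD[OF AX that] \<open>e \<in> E\<close>] ea[OF that] False by simp
      then show ?thesis using submodule_zero[OF AB(1)] by blast
    qed
    then show False using AB by blast
  qed
  with ds show ?thesis by blast
qed

end

theorem corollary5p15:
  fixes scale :: "'k::{alg_closed_field,field_char_0} \<Rightarrow> 'g::ab_group_add \<Rightarrow> 'g"
    and bracket :: "'g \<Rightarrow> 'g \<Rightarrow> 'g"
    and G :: "nat \<Rightarrow> 'g set" and h b :: "'g set"
    and scaleM :: "'k \<Rightarrow> 'm::ab_group_add \<Rightarrow> 'm" and act :: "'g \<Rightarrow> 'm \<Rightarrow> 'm"
  assumes "lie_algebra scale bracket"
    and "lie_algebra.root_reductive scale bracket"
    and "lie_algebra.splitting_maximal_toral scale bracket h"
    and "lie_algebra.splitting_borel scale bracket b"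
    and "h \<subseteq> b"
    and "lie_algebra.root_reductive_exhaustion scale bracket G"
    and "\<forall>n. lie_algebra.maximal_toral_in scale bracket (h \<inter> G n) (G n)"
    and "\<forall>n. lie_algebra.borel_subalgebra_in scale bracket (b \<inter> G n) (G n)"
    and "lie_module scale bracket scaleM act"
    and "lie_module.category_O_bar scale bracket scaleM act b h UNIV"
  shows "(\<exists>(J :: 'm set set) N.
            lie_module.indecomposable_decomposition scale bracket scaleM act b h J N) \<and>
         (\<forall>(J :: 'i set) N (J' :: 'j set) N'.
            lie_module.indecomposable_decomposition scale bracket scaleM act b h J N \<and>
            lie_module.indecomposable_decomposition scale bracket scaleM act b h J' N' \<longrightarrow>
            (\<exists>\<psi>. bij_betw \<psi> J J' \<and>
                 (\<forall>j\<in>J. lie_module.isomorphic scaleM act (N j) (N' (\<psi> j)))))"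
proof -
  interpret lie_module scale bracket scaleM act by fact
  note O_bar = \<open>category_O_bar b h UNIV\<close>
  interpret finite_weight_module scale bracket scaleM act h
    using O_bar by unfold_locales (auto simp: category_O_bar_def)
  have "\<exists>J N. indecomposable_decomposition b h (J :: 'm set set) N"
  proof -
    obtain J where "M.direct_sum UNIV J (\<lambda>X. X)" "\<forall>X\<in>J. indecomposable X"
      using decomposition_exists by blast
    then have "indecomposable_decomposition b h J (\<lambda>X. X)"
      unfolding indecomposable_decomposition_def indecomposable_object_iff[OF O_bar] by (rule conjI)
    then show ?thesis by (intro exI)
  qed
  moreover have "\<exists>\<psi>. bij_betw \<psi> J J' \<and> (\<forall>j\<in>J. isomorphic (N j) (N' (\<psi> j)))"
    if "indecomposable_decomposition b h J N" "indecomposable_decomposition b h J' N'"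
    for J :: "'i set" and N and J' :: "'j set" and N'
    using that unfolding indecomposable_decomposition_def indecomposable_object_iff[OF O_bar]
    by (intro decomposition_unique) simp_all
  ultimately show ?thesis by blast
qed

end
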